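(* Let $\mathcal{A}$ be a dual Banach algebra and let $\varphi\in\Delta_{wk^{\ast}}(\mathcal{A})$. Then $\mathcal{A}$ is $\varphi$-Connes amenable if and only if there exists a bounded net $\{u_{\alpha}\}$ in $\mathcal{A}\hat{\otimes}\mathcal{A}$ such that (i) for every $a\in\mathcal{A}$, $a\cdot u_{\alpha}-\varphi(a)u_{\alpha}\to 0$ in the $wk^{\ast}$-topology of $\left(\sigma wc\left((\mathcal{A}\hat{\otimes}\mathcal{A})^{\ast}\right)\right)^{\ast}$; and (ii) $\langle u_{\alpha},\varphi\otimes\varphi\rangle\to 1$.
   Context: All spaces and algebras are over $\mathbb{C}$. For a Banach algebra $\mathcal{A}$ and a Banach $\mathcal{A}$-bimodule $E$, the dual $E^{\ast}$ is a Banach $\mathcal{A}$-bimodule via $(f\cdot a)(x)=f(a\cdot x)$ and $(a\cdot f)(x)=f(x\cdot a)$. $\mathcal{A}$ is a dual Banach algebra if there is a closed $\mathcal{A}$-submodule $\mathcal{A}_{\ast}$ of $\mathcal{A}^{\ast}$ (the predual, which is fixed) such that $\mathcal{A}=(\mathcal{A}_{\ast})^{\ast}$ (isometrically, via the evaluation pairing). The $wk^{\ast}$-topology on $\mathcal{A}$ is $\sigma(\mathcal{A},\mathcal{A}_{\ast})$. $\Delta_{wk^{\ast}}(\mathcal{A})$ denotes the set of all non-zero $wk^{\ast}$-continuous (multiplicative linear) homomorphisms $\mathcal{A}\to\mathbb{C}$. For a Banach $\mathcal{A}$-bimodule $E$, $\sigma wc(E)$ is the set of all $x\in E$ such that the maps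 $\mathcal{A}\to E$, $a\mapsto a\cdot x$ and $a\mapsto x\cdot a$, are continuous from the $wk^{\ast}$-topology of $\mathcal{A}$ to the weak topology of $E$; it is a closed submodule of $E$. For $\varphi\in\Delta_{wk^{\ast}}(\mathcal{A})$, $\mathcal{A}$ is called $\varphi$-Connes amenable if there is a bounded linear functional $m$ on $\sigma wc(\mathcal{A}^{\ast})$ such that $m(\varphi)=1$ and $m(f\cdot a)=\varphi(a)m(f)$ for all $a\in\mathcal{A}$ and $f\in\sigma wc(\mathcal{A}^{\ast})$. $\mathcal{A}\hat{\otimes}\mathcal{A}$ is the projective tensor product, a Banach $\mathcal{A}$-bimodule via $a\cdot(b\otimes c)=ab\otimes c$ and $(b\otimes c)\cdot a=b\otimes ca$. The functional $\varphi\otimes\varphi\in(\mathcal{A}\hat{\otimes}\mathcal{A})^{\ast}$ is determined by $(\varphi\otimes\varphi)(a\otimes b)=\varphi(a)\varphi(b)$; it lies in $\sigma wc((\mathcal{A}\hat{\otimes}\mathcal{A})^{\ast})$. An element $u\in\mathcal{A}\hat{\otimes}\mathcal{A}$ is regarded as an element of $(\sigma wc((\mathcal{A}\hat{\otimes}\mathcal{A})^{\ast}))^{\ast}$ via $T\mapsto T(u)$; thus (i) means $T(a\cdot u_\alpha-\varphi(a)u_\alpha)\to 0$ for all $T\in\sigma wc((\mathcal{A}\hat{\otimes}\mathcal{A})^{\ast})$. *)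

theory Defs
  imports "HOL-Analysis.Analysis"
begin

section \<open>Complex Banach spaces and Banach algebras\<close>

text \<open>
  \<^theory>\<open>HOL-Analysis.Analysis\<close> only has real normed spaces; a complex structure is a scalar
  multiplication by \<^typ>\<open>complex\<close> extending the real one.  Algebras are not assumed to be unital.
\<close>

class complex_vector = real_vector +
  fixes scaleC :: "complex \<Rightarrow> 'a \<Rightarrow> 'a"  (infixr "*\<^sub>C" 75)
  assumes scaleC_add_right: "c *\<^sub>C (x + y) = c *\<^sub>C x + c *\<^sub>C y"
    and scaleC_add_left: "(c + d) *\<^sub>C x = c *\<^sub>C x + d *\<^sub>C x"
    and scaleC_scaleC: "c *\<^sub>C d *\<^sub>C x = (c * d) *\<^sub>C x"
    and scaleC_one: "1 *\<^sub>C x = x"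
    and scaleR_scaleC: "r *\<^sub>R x = complex_of_real r *\<^sub>C x"

class complex_normed_vector = complex_vector + real_normed_vector +
  assumes norm_scaleC: "norm (c *\<^sub>C x) = cmod c * norm x"

class complex_banach = complex_normed_vector + complete_space
begin
subclass banach ..
end

class complex_banach_algebra = complex_banach + real_normed_algebra +
  assumes scaleC_mult_left: "(c *\<^sub>C x) * y = c *\<^sub>C (x * y)"
    and scaleC_mult_right: "x * (c *\<^sub>C y) = c *\<^sub>C (x * y)"

lemma scaleC_vector_space: "vector_space (scaleC :: complex \<Rightarrow> 'a::complex_vector \<Rightarrow> 'a)"
  by unfold_locales (simp_all add: scaleC_add_right scaleC_add_left scaleC_scaleC scaleC_one)

lemma scaleC_minus1: "(- 1) *\<^sub>C x = - (x::'a::complex_vector)"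
  by (metis of_real_1 of_real_minus scaleR_minus1_left scaleR_scaleC)

lemma scaleC_zero_left [simp]: "0 *\<^sub>C x = (0::'a::complex_vector)"
  by (metis of_real_0 scaleR_zero_left scaleR_scaleC)

lemma scaleC_zero_right [simp]: "c *\<^sub>C 0 = (0::'a::complex_vector)"
  using scaleC_add_right[of c 0 "0::'a"] by simp

lemma scaleC_minus_right: "c *\<^sub>C (- x) = - (c *\<^sub>C (x::'a::complex_vector))"
  by (metis mult.commute scaleC_minus1 scaleC_scaleC)

lemma scaleC_diff_right: "c *\<^sub>C (x - y) = c *\<^sub>C x - c *\<^sub>C (y::'a::complex_vector)"
  by (metis add_uminus_conv_diff scaleC_add_right scaleC_minus_right)

instantiation complex :: complex_banach_algebra
begin

definition scaleC_complex :: "complex \<Rightarrow> complex \<Rightarrow> complex"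
  where "scaleC_complex c x = c * x"

instance
  by standard (simp_all add: scaleC_complex_def algebra_simps norm_mult scaleR_conv_of_real)

end

definition clinear :: "('a::complex_vector \<Rightarrow> 'b::complex_vector) \<Rightarrow> bool"
  where "clinear f \<longleftrightarrow> (\<forall>x y. f (x + y) = f x + f y) \<and> (\<forall>c x. f (c *\<^sub>C x) = c *\<^sub>C f x)"

definition bounded_clinear :: "('a::complex_normed_vector \<Rightarrow> 'b::complex_normed_vector) \<Rightarrow> bool"
  where "bounded_clinear f \<longleftrightarrow> clinear f \<and> (\<exists>K. \<forall>x. norm (f x) \<le> K * norm x)"

definition cbilinear :: "('a::complex_vector \<Rightarrow> 'b::complex_vector \<Rightarrow> 'c::complex_vector) \<Rightarrow> bool"
  where "cbilinear B \<longleftrightarrow> (\<forall>x. clinear (B x)) \<and> (\<forall>y. clinear (\<lambda>x. B x y))"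

definition bounded_cbilinear ::
    "('a::complex_normed_vector \<Rightarrow> 'b::complex_normed_vector \<Rightarrow> 'c::complex_normed_vector) \<Rightarrow> bool"
  where "bounded_cbilinear B \<longleftrightarrow> cbilinear B \<and> (\<exists>K. \<forall>x y. norm (B x y) \<le> K * norm x * norm y)"

definition bounded_clinear_on :: "'a::complex_normed_vector set \<Rightarrow> ('a \<Rightarrow> complex) \<Rightarrow> bool"
  where "bounded_clinear_on S m \<longleftrightarrow>
    (\<forall>x\<in>S. \<forall>y\<in>S. m (x + y) = m x + m y) \<and>
    (\<forall>c. \<forall>x\<in>S. m (c *\<^sub>C x) = c * m x) \<and>
    (\<exists>K. \<forall>x\<in>S. cmod (m x) \<le> K * norm x)"

definition csubspace :: "'a::complex_vector set \<Rightarrow> bool"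
  where "csubspace S \<longleftrightarrow>
    0 \<in> S \<and> (\<forall>x\<in>S. \<forall>y\<in>S. x + y \<in> S) \<and> (\<forall>c. \<forall>x\<in>S. c *\<^sub>C x \<in> S)"

lemma clinearD:
  assumes "clinear f"
  shows "f (x + y) = f x + f y" "f (c *\<^sub>C x) = c *\<^sub>C f x" "f 0 = 0" "f (- x) = - f x"
    "f (x - y) = f x - f y" "f (r *\<^sub>R x) = r *\<^sub>R f x"
proof -
  show 1: "f (x + y) = f x + f y" for x y using assms by (simp add: clinear_def)
  show 2: "f (c *\<^sub>C x) = c *\<^sub>C f x" for c x using assms by (simp add: clinear_def)
  show "f 0 = 0" using 1[of 0 0] by simp
  show 3: "f (- x) = - f x" for x using 2[of "-1" x] by (simp add: scaleC_minus1)
  show "f (x - y) = f x - f y" using 1[of x "- y"] 3[of y] by simp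
  show "f (r *\<^sub>R x) = r *\<^sub>R f x" by (simp add: scaleR_scaleC 2)
qed

lemma bounded_clinear_imp_bounded_linear:
  assumes "bounded_clinear f" shows "bounded_linear f"
proof -
  obtain K where "\<forall>x. norm (f x) \<le> K * norm x" and "clinear f"
    using assms by (auto simp: bounded_clinear_def)
  then show ?thesis
    by (intro bounded_linear_intro[where K=K]) (auto simp: clinearD mult.commute)
qed

lemma bounded_clinear_iff:
  "bounded_clinear f \<longleftrightarrow> bounded_linear f \<and> (\<forall>c x. f (c *\<^sub>C x) = c *\<^sub>C f x)"
proof
  assume "bounded_clinear f"
  then show "bounded_linear f \<and> (\<forall>c x. f (c *\<^sub>C x) = c *\<^sub>C f x)"
    using bounded_clinear_imp_bounded_linear by (auto simp: bounded_clinear_def clinear_def)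
next
  assume a: "bounded_linear f \<and> (\<forall>c x. f (c *\<^sub>C x) = c *\<^sub>C f x)"
  then interpret bounded_linear f by simp
  show "bounded_clinear f"
    using a bounded add by (auto simp: bounded_clinear_def clinear_def mult.commute)
qed


section \<open>The dual space\<close>

typedef (overloaded) ('a::complex_normed_vector) cdual =
    "{f :: 'a \<Rightarrow>\<^sub>L complex. \<forall>c x. blinfun_apply f (c *\<^sub>C x) = c * blinfun_apply f x}"
  by (rule exI[where x=0]) simp

setup_lifting type_definition_cdual

instantiation cdual :: (complex_normed_vector) complex_normed_vector
begin

lift_definition norm_cdual :: "'a cdual \<Rightarrow> real" is norm .

lift_definition minus_cdual :: "'a cdual \<Rightarrow> 'a cdual \<Rightarrow> 'a cdual" is "(-)"
  by (simp add: blinfun.bilinear_simps algebra_simps)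

lift_definition plus_cdual :: "'a cdual \<Rightarrow> 'a cdual \<Rightarrow> 'a cdual" is "(+)"
  by (simp add: blinfun.bilinear_simps algebra_simps)

lift_definition uminus_cdual :: "'a cdual \<Rightarrow> 'a cdual" is "uminus"
  by (simp add: blinfun.bilinear_simps algebra_simps)

lift_definition zero_cdual :: "'a cdual" is 0
  by simp

lift_definition scaleR_cdual :: "real \<Rightarrow> 'a cdual \<Rightarrow> 'a cdual" is "scaleR"
  by (simp add: blinfun.bilinear_simps algebra_simps)

lift_definition scaleC_cdual :: "complex \<Rightarrow> 'a cdual \<Rightarrow> 'a cdual"
  is "\<lambda>c f. blinfun_compose (blinfun_mult_right c) f"
  by (simp add: algebra_simps)

definition dist_cdual :: "'a cdual \<Rightarrow> 'a cdual \<Rightarrow> real"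
  where "dist_cdual a b = norm (a - b)"

definition
  "(uniformity :: ('a cdual \<times> 'a cdual) filter) = (INF e\<in>{0 <..}. principal {(x, y). dist x y < e})"

definition open_cdual :: "'a cdual set \<Rightarrow> bool"
  where "open_cdual S = (\<forall>x\<in>S. \<forall>\<^sub>F (x', y) in uniformity. x' = x \<longrightarrow> y \<in> S)"

definition sgn_cdual :: "'a cdual \<Rightarrow> 'a cdual"
  where "sgn_cdual x = scaleR (inverse (norm x)) x"

lemma norm_mult_right_compose:
  "norm (blinfun_compose (blinfun_mult_right c) f) = cmod c * norm (f :: 'a \<Rightarrow>\<^sub>L complex)"
proof (rule antisym)
  show "norm (blinfun_compose (blinfun_mult_right c) f) \<le> cmod c * norm f"
    by (rule norm_blinfun_bound)
      (auto simp: norm_mult mult.assoc intro!: mult_left_mono norm_blinfun)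
  show "cmod c * norm f \<le> norm (blinfun_compose (blinfun_mult_right c) f)"
  proof (cases "c = 0")
    case False
    have "norm f \<le> norm (blinfun_compose (blinfun_mult_right c) f) / cmod c"
    proof (rule norm_blinfun_bound)
      fix x
      have "cmod c * cmod (blinfun_apply f x) = cmod (blinfun_apply (blinfun_compose (blinfun_mult_right c) f) x)"
        by (simp add: norm_mult)
      also have "\<dots> \<le> norm (blinfun_compose (blinfun_mult_right c) f) * norm x"
        by (rule norm_blinfun)
      finally show "norm (blinfun_apply f x) \<le>
          norm (blinfun_compose (blinfun_mult_right c) f) / cmod c * norm x"
        using False by (simp add: field_simps)
    qed simp
    with False show ?thesis by (simp add: field_simps)
  qed simp
qed

instance
proof
  fix a b c :: "'a cdual" and r s :: real and z w :: complex
  show "a + b + c = a + (b + c)" "a + b = b + a" "0 + a = a" "- a + a = 0" "a - b = a + - b"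
    by (transfer, simp)+
  show "r *\<^sub>R (a + b) = r *\<^sub>R a + r *\<^sub>R b" "(r + s) *\<^sub>R a = r *\<^sub>R a + s *\<^sub>R a"
    "r *\<^sub>R s *\<^sub>R a = (r * s) *\<^sub>R a" "1 *\<^sub>R a = a"
    by (transfer, simp add: algebra_simps)+
  show "z *\<^sub>C (a + b) = z *\<^sub>C a + z *\<^sub>C b" "(z + w) *\<^sub>C a = z *\<^sub>C a + w *\<^sub>C a"
    "z *\<^sub>C w *\<^sub>C a = (z * w) *\<^sub>C a" "1 *\<^sub>C a = a" "r *\<^sub>R a = complex_of_real r *\<^sub>C a"
    by (transfer, auto intro!: blinfun_eqI simp: blinfun.bilinear_simps algebra_simps scaleR_conv_of_real)+
  show "sgn a = inverse (norm a) *\<^sub>R a" by (simp add: sgn_cdual_def)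
  show "dist a b = norm (a - b)" by (simp add: dist_cdual_def)
  show "(uniformity :: ('a cdual \<times> 'a cdual) filter) = (INF e\<in>{0 <..}. principal {(x, y). dist x y < e})"
    by (rule uniformity_cdual_def)
  show "open U = (\<forall>x\<in>U. \<forall>\<^sub>F (x', y) in uniformity. x' = x \<longrightarrow> y \<in> U)" for U :: "'a cdual set"
    by (rule open_cdual_def)
  show "(norm a = 0) = (a = 0)" by transfer simp
  show "norm (a + b) \<le> norm a + norm b" by transfer (rule norm_triangle_ineq)
  show "norm (r *\<^sub>R a) = \<bar>r\<bar> * norm a" by transfer simp
  show "norm (z *\<^sub>C a) = cmod z * norm a" by transfer (rule norm_mult_right_compose)
qed

end

lift_definition cdual_apply :: "'a::complex_normed_vector cdual \<Rightarrow> 'a \<Rightarrow> complex" is blinfun_apply .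

text \<open>The element of the dual space given by a bounded linear functional; meaningless for other arguments.\<close>

definition CDual :: "('a::complex_normed_vector \<Rightarrow> complex) \<Rightarrow> 'a cdual"
  where "CDual f = (THE F. cdual_apply F = f)"

lemma cdual_apply_bounded_clinear: "bounded_clinear (cdual_apply F)"
  unfolding bounded_clinear_iff scaleC_complex_def
  by transfer (simp add: blinfun.bounded_linear_right)

lemma cdual_apply_inject: "cdual_apply F = cdual_apply G \<longleftrightarrow> F = G"
  by transfer (auto simp: blinfun_apply_inject)

lemma cdual_eqI: "(\<And>x. cdual_apply F x = cdual_apply G x) \<Longrightarrow> F = G"
  using cdual_apply_inject by blast

lemma cdual_apply_CDual: 
  assumes "bounded_clinear f" shows "cdual_apply (CDual f) = f"
proof -
  have bl: "bounded_linear f" and c: "\<And>c x. f (c *\<^sub>C x) = c * f x"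
    using assms by (auto simp: bounded_clinear_iff scaleC_complex_def)
  have "cdual_apply (Abs_cdual (Blinfun f)) = f"
    by (simp add: cdual_apply.rep_eq Abs_cdual_inverse bounded_linear_Blinfun_apply bl c)
  then have "\<exists>!F. cdual_apply F = f" by (metis cdual_apply_inject)
  then show ?thesis
    unfolding CDual_def by (rule theI')
qed

lemma CDual_cdual_apply [simp]: "CDual (cdual_apply F) = F"
  using cdual_apply_CDual cdual_apply_bounded_clinear cdual_apply_inject by blast

lemma cdual_apply_simps [simp]:
  "cdual_apply (F + G) x = cdual_apply F x + cdual_apply G x"
  "cdual_apply (F - G) x = cdual_apply F x - cdual_apply G x"
  "cdual_apply (- F) x = - cdual_apply F x"
  "cdual_apply 0 x = 0"
  "cdual_apply (c *\<^sub>C F) x = c * cdual_apply F x"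
  by (transfer, simp add: blinfun.bilinear_simps)+

lemma norm_cdual_apply: "cmod (cdual_apply F x) \<le> norm F * norm x"
  by transfer (rule norm_blinfun)

lemma norm_cdual_bound:
  "0 \<le> K \<Longrightarrow> (\<And>x. cmod (cdual_apply F x) \<le> K * norm x) \<Longrightarrow> norm F \<le> K"
  by transfer (rule norm_blinfun_bound)

instance cdual :: (complex_normed_vector) complex_banach
proof
  fix X :: "nat \<Rightarrow> 'a cdual" assume X: "Cauchy X"
  have d: "dist (Rep_cdual x) (Rep_cdual y) = dist x y" for x y :: "'a cdual"
    by (simp add: dist_norm norm_cdual.rep_eq minus_cdual.rep_eq)
  from X have "Cauchy (\<lambda>n. Rep_cdual (X n))" by (simp add: Cauchy_def d)
  then obtain L where L: "(\<lambda>n. Rep_cdual (X n)) \<longlonglongrightarrow> L"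
    using Cauchy_convergent convergent_def by blast
  have "blinfun_apply L (c *\<^sub>C x) = c * blinfun_apply L x" for c x
  proof -
    have *: "(\<lambda>n. blinfun_apply (Rep_cdual (X n)) y) \<longlonglongrightarrow> blinfun_apply L y" for y
      using L by (intro tendsto_intros)
    have "blinfun_apply (Rep_cdual (X n)) (c *\<^sub>C x) = c * blinfun_apply (Rep_cdual (X n)) x" for n
      using Rep_cdual[of "X n"] by blast
    then have "(\<lambda>n. blinfun_apply (Rep_cdual (X n)) (c *\<^sub>C x)) \<longlonglongrightarrow> c * blinfun_apply L x"
      by (simp add: tendsto_mult_left *)
    then show ?thesis using * LIMSEQ_unique by blast
  qed
  then have "Rep_cdual (Abs_cdual L) = L" by (simp add: Abs_cdual_inverse)
  then have "X \<longlonglongrightarrow> Abs_cdual L"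
    using L by (simp add: tendsto_iff flip: d)
  then show "convergent X" by (auto simp: convergent_def)
qed


section \<open>The projective tensor product\<close>

subsection \<open>The algebraic tensor product and the projective seminorm\<close>

text \<open>
  The elementary tensor of \<^term>\<open>a\<close> and \<^term>\<open>b\<close> is evaluation at \<^term>\<open>(a, b)\<close> on the space of
  all bilinear forms, and the algebraic tensor product is the span of these evaluations.
\<close>

definition tensor_eval :: "('a::complex_vector \<times> 'b::complex_vector) list \<Rightarrow> ('a \<Rightarrow> 'b \<Rightarrow> complex) \<Rightarrow> complex"
  where "tensor_eval xs \<beta> = (if cbilinear \<beta> then \<Sum>(a, b)\<leftarrow>xs. \<beta> a b else 0)"

typedef (overloaded) ('a::complex_vector, 'b::complex_vector) atensor =
    "range (tensor_eval :: ('a \<times> 'b) list \<Rightarrow> _)"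
  by blast

setup_lifting type_definition_atensor

lift_definition formal_sum :: "('a::complex_vector \<times> 'b::complex_vector) list \<Rightarrow> ('a, 'b) atensor"
  is tensor_eval by simp

lemma tensor_eval_Nil: "tensor_eval [] = (\<lambda>_. 0)"
  by (simp add: tensor_eval_def fun_eq_iff)

lemma tensor_eval_append: "tensor_eval (xs @ ys) = (\<lambda>\<beta>. tensor_eval xs \<beta> + tensor_eval ys \<beta>)"
  by (simp add: tensor_eval_def fun_eq_iff)

lemma tensor_eval_scale:
  "tensor_eval (map (\<lambda>(a, b). (c *\<^sub>C a, b)) xs) = (\<lambda>\<beta>. c * tensor_eval xs \<beta>)"
proof (rule ext)
  fix \<beta> :: "'a \<Rightarrow> 'b \<Rightarrow> complex"
  show "tensor_eval (map (\<lambda>(a, b). (c *\<^sub>C a, b)) xs) \<beta> = c * tensor_eval xs \<beta>"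
  proof (cases "cbilinear \<beta>")
    case True
    then have "\<beta> (c *\<^sub>C a) b = c * \<beta> a b" for a b
      by (simp add: cbilinear_def clinear_def scaleC_complex_def)
    then show ?thesis
      using True by (induction xs) (auto simp: tensor_eval_def algebra_simps)
  qed (simp add: tensor_eval_def)
qed

instantiation atensor :: (complex_vector, complex_vector) complex_vector
begin

lift_definition zero_atensor :: "('a, 'b) atensor" is "\<lambda>_. 0"
  by (rule range_eqI[where x="[]"]) (simp add: tensor_eval_Nil)

lift_definition plus_atensor :: "('a, 'b) atensor \<Rightarrow> ('a, 'b) atensor \<Rightarrow> ('a, 'b) atensor"
  is "\<lambda>u v \<beta>. u \<beta> + v \<beta>"
  by (auto simp flip: tensor_eval_append)

lift_definition scaleC_atensor :: "complex \<Rightarrow> ('a, 'b) atensor \<Rightarrow> ('a, 'b) atensor"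
  is "\<lambda>c u \<beta>. c * u \<beta>"
  by (auto simp flip: tensor_eval_scale)

lift_definition uminus_atensor :: "('a, 'b) atensor \<Rightarrow> ('a, 'b) atensor" is "\<lambda>u \<beta>. - u \<beta>"
proof -
  fix u :: "('a \<Rightarrow> 'b \<Rightarrow> complex) \<Rightarrow> complex" assume "u \<in> range tensor_eval"
  then obtain xs where "u = tensor_eval xs" by blast
  then have "(\<lambda>\<beta>. - u \<beta>) = tensor_eval (map (\<lambda>(a, b). ((- 1) *\<^sub>C a, b)) xs)"
    by (subst tensor_eval_scale) simp
  then show "(\<lambda>\<beta>. - u \<beta>) \<in> range tensor_eval" by blast
qed

definition minus_atensor :: "('a, 'b) atensor \<Rightarrow> ('a, 'b) atensor \<Rightarrow> ('a, 'b) atensor"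
  where "minus_atensor u v = u + - v"

definition scaleR_atensor :: "real \<Rightarrow> ('a, 'b) atensor \<Rightarrow> ('a, 'b) atensor"
  where "scaleR_atensor r u = complex_of_real r *\<^sub>C u"

instance
  by standard
    (unfold minus_atensor_def scaleR_atensor_def,
      (transfer, simp add: fun_eq_iff algebra_simps)+)

end

lemma formal_sum_simps:
  "formal_sum [] = 0"
  "formal_sum (xs @ ys) = formal_sum xs + formal_sum ys"
  "formal_sum (map (\<lambda>(a, b). (c *\<^sub>C a, b)) xs) = c *\<^sub>C formal_sum xs"
  by (transfer, simp add: tensor_eval_Nil tensor_eval_append tensor_eval_scale)+

lemma formal_sum_Cons: "formal_sum (x # xs) = formal_sum [x] + formal_sum xs"
  using formal_sum_simps(2)[of "[x]" xs] by simp

lemma formal_sum_surj: "\<exists>xs. u = formal_sum xs"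
  by transfer auto

class complex_seminormed_vector = complex_vector +
  fixes seminorm :: "'a \<Rightarrow> real"
  assumes seminorm_triangle: "seminorm (x + y) \<le> seminorm x + seminorm y"
    and seminorm_scaleC: "seminorm (c *\<^sub>C x) = cmod c * seminorm x"

definition formal_cost :: "('a::complex_normed_vector \<times> 'b::complex_normed_vector) list \<Rightarrow> real"
  where "formal_cost xs = (\<Sum>(a, b)\<leftarrow>xs. norm a * norm b)"

lemma formal_cost_nonneg: "0 \<le> formal_cost xs"
  by (induction xs) (auto simp: formal_cost_def)

instantiation atensor :: (complex_normed_vector, complex_normed_vector) complex_seminormed_vector
begin

definition seminorm_atensor :: "('a, 'b) atensor \<Rightarrow> real"
  where "seminorm_atensor u = Inf {formal_cost xs |xs. formal_sum xs = u}"

lemma seminorm_atensor_le: "formal_sum xs = u \<Longrightarrow> seminorm u \<le> formal_cost (xs :: ('a \<times> 'b) list)"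
  unfolding seminorm_atensor_def
  by (rule cInf_lower) (auto intro!: bdd_belowI[where m=0] formal_cost_nonneg)

lemma seminorm_atensor_ge:
  "(\<And>xs. formal_sum xs = u \<Longrightarrow> k \<le> formal_cost (xs :: ('a \<times> 'b) list)) \<Longrightarrow> k \<le> seminorm u"
  unfolding seminorm_atensor_def using formal_sum_surj[of u] by (intro cInf_greatest) auto

lemma seminorm_atensor_less:
  assumes "0 < e" shows "\<exists>xs :: ('a \<times> 'b) list. formal_sum xs = u \<and> formal_cost xs < seminorm u + e"
  using assms seminorm_atensor_ge[of u "seminorm u + e"] by force

lemma seminorm_atensor_scale_le: "seminorm (c *\<^sub>C u) \<le> cmod c * seminorm (u :: ('a, 'b) atensor)"
proof (cases "c = 0")
  case True
  have "formal_sum ([] :: ('a \<times> 'b) list) = c *\<^sub>C u" using True by (simp add: formal_sum_simps)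
  from seminorm_atensor_le[OF this] True show ?thesis by (simp add: formal_cost_def)
next
  case False
  have "seminorm (c *\<^sub>C u) / cmod c \<le> seminorm u"
  proof (rule seminorm_atensor_ge)
    fix xs :: "('a \<times> 'b) list" assume "formal_sum xs = u"
    then have "seminorm (c *\<^sub>C u) \<le> formal_cost (map (\<lambda>(a, b). (c *\<^sub>C a, b)) xs)"
      by (intro seminorm_atensor_le) (simp add: formal_sum_simps)
    also have "\<dots> = cmod c * formal_cost xs"
      by (induction xs) (auto simp: formal_cost_def norm_scaleC algebra_simps)
    finally show "seminorm (c *\<^sub>C u) / cmod c \<le> formal_cost xs"
      using False by (simp add: field_simps)
  qed
  with False show ?thesis by (simp add: field_simps)
qed

instance
proof
  fix u v :: "('a, 'b) atensor" and c :: complex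
  show "seminorm (u + v) \<le> seminorm u + seminorm v"
  proof (rule field_le_epsilon)
    fix e :: real assume "0 < e"
    then obtain xs ys :: "('a \<times> 'b) list" where xs: "formal_sum xs = u" "formal_cost xs < seminorm u + e / 2"
      and ys: "formal_sum ys = v" "formal_cost ys < seminorm v + e / 2"
      using seminorm_atensor_less[of "e / 2" u] seminorm_atensor_less[of "e / 2" v] by auto
    have "seminorm (u + v) \<le> formal_cost (xs @ ys)"
      by (rule seminorm_atensor_le) (simp add: formal_sum_simps xs ys)
    then show "seminorm (u + v) \<le> seminorm u + seminorm v + e"
      using xs ys by (simp add: formal_cost_def)
  qed
  show "seminorm (c *\<^sub>C u) = cmod c * seminorm u"
  proof (cases "c = 0")
    case True
    have "0 \<le> seminorm (c *\<^sub>C u)"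
      by (rule seminorm_atensor_ge) (rule formal_cost_nonneg)
    with True seminorm_atensor_scale_le[of c u] show ?thesis by simp
  next
    case False
    have "seminorm u \<le> seminorm (c *\<^sub>C u) / cmod c"
      using seminorm_atensor_scale_le[of "inverse c" "c *\<^sub>C u"] False
      by (simp add: scaleC_scaleC scaleC_one norm_inverse divide_inverse mult.commute)
    with False seminorm_atensor_scale_le[of c u] show ?thesis by (simp add: field_simps)
  qed
qed

end


subsection \<open>The completion of a seminormed space\<close>

lemma seminorm_0 [simp]: "seminorm (0::'v::complex_seminormed_vector) = 0"
  using seminorm_scaleC[of 0 "0::'v"] by simp

lemma seminorm_minus: "seminorm (- x) = seminorm (x::'v::complex_seminormed_vector)"
  using seminorm_scaleC[of "-1" x] by (simp add: scaleC_minus1)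

lemma seminorm_minus_commute: "seminorm (x - y) = seminorm (y - x::'v::complex_seminormed_vector)"
  by (metis minus_diff_eq seminorm_minus)

lemma seminorm_nonneg: "0 \<le> seminorm (x::'v::complex_seminormed_vector)"
  using seminorm_triangle[of x "-x"] by (simp add: seminorm_minus)

lemma seminorm_diff_triangle:
  "seminorm (x - z) \<le> seminorm (x - y) + seminorm (y - z::'v::complex_seminormed_vector)"
  using seminorm_triangle[of "x - y" "y - z"] by simp

lemma seminorm_abs_diff:
  "\<bar>seminorm x - seminorm y\<bar> \<le> seminorm (x - y::'v::complex_seminormed_vector)"
  using seminorm_triangle[of "x - y" y] seminorm_triangle[of "y - x" x] seminorm_minus_commute[of x y]
  by simp

definition scauchy :: "(nat \<Rightarrow> 'v::complex_seminormed_vector) \<Rightarrow> bool"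
  where "scauchy X \<longleftrightarrow> (\<forall>e>0. \<exists>N. \<forall>m\<ge>N. \<forall>n\<ge>N. seminorm (X m - X n) < e)"

definition completion_rel ::
    "(nat \<Rightarrow> 'v::complex_seminormed_vector) \<Rightarrow> (nat \<Rightarrow> 'v) \<Rightarrow> bool"
  where "completion_rel X Y \<longleftrightarrow>
    scauchy X \<and> scauchy Y \<and> (\<lambda>n. seminorm (X n - Y n)) \<longlonglongrightarrow> 0"

lemma scauchyD: "scauchy X \<Longrightarrow> 0 < e \<Longrightarrow> \<exists>N. \<forall>m\<ge>N. \<forall>n\<ge>N. seminorm (X m - X n) < e"
  by (simp add: scauchy_def)

lemma scauchy_const: "scauchy (\<lambda>_. v)"
  by (simp add: scauchy_def)

lemma scauchy_add:
  assumes "scauchy X" "scauchy Y" shows "scauchy (\<lambda>n. X n + Y n)"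
  unfolding scauchy_def
proof (intro allI impI)
  fix e :: real assume "e > 0"
  then obtain M N where M: "\<forall>m\<ge>M. \<forall>n\<ge>M. seminorm (X m - X n) < e / 2"
    and N: "\<forall>m\<ge>N. \<forall>n\<ge>N. seminorm (Y m - Y n) < e / 2"
    using assms[THEN scauchyD, of "e / 2"] by auto
  have "seminorm (X m + Y m - (X n + Y n)) < e" if "m \<ge> max M N" "n \<ge> max M N" for m n
  proof -
    have "seminorm (X m + Y m - (X n + Y n)) \<le> seminorm (X m - X n) + seminorm (Y m - Y n)"
      using seminorm_triangle[of "X m - X n" "Y m - Y n"] by (simp add: algebra_simps)
    also have "\<dots> < e / 2 + e / 2"
      using M N that by (intro add_strict_mono) auto
    finally show ?thesis by simp
  qed
  then show "\<exists>N. \<forall>m\<ge>N. \<forall>n\<ge>N. seminorm (X m + Y m - (X n + Y n)) < e" by blast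
qed

lemma scauchy_scaleC:
  assumes "scauchy X" shows "scauchy (\<lambda>n. c *\<^sub>C X n)"
  unfolding scauchy_def
proof (intro allI impI)
  fix e :: real assume "e > 0"
  then have "e / (cmod c + 1) > 0"
    by (simp add: add_nonneg_pos)
  then obtain N where N: "\<forall>m\<ge>N. \<forall>n\<ge>N. seminorm (X m - X n) < e / (cmod c + 1)"
    using assms unfolding scauchy_def by blast
  have "seminorm (c *\<^sub>C X m - c *\<^sub>C X n) < e" if "m \<ge> N" "n \<ge> N" for m n
  proof -
    have "seminorm (c *\<^sub>C X m - c *\<^sub>C X n) = cmod c * seminorm (X m - X n)"
      by (metis scaleC_diff_right seminorm_scaleC)
    also have "\<dots> \<le> (cmod c + 1) * seminorm (X m - X n)"
      by (simp add: mult_right_mono seminorm_nonneg)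
    also have "\<dots> < e"
      using N that by (simp add: pos_less_divide_eq add_nonneg_pos mult.commute)
    finally show ?thesis .
  qed
  then show "\<exists>N. \<forall>m\<ge>N. \<forall>n\<ge>N. seminorm (c *\<^sub>C X m - c *\<^sub>C X n) < e" by blast
qed

lemma scauchy_minus: "scauchy X \<Longrightarrow> scauchy (\<lambda>n. - X n)"
  using scauchy_scaleC[of X "-1"] by (simp add: scaleC_minus1)

lemma scauchy_diff: "scauchy X \<Longrightarrow> scauchy Y \<Longrightarrow> scauchy (\<lambda>n. X n - Y n)"
  using scauchy_add[of X "\<lambda>n. - Y n"] scauchy_minus[of Y] by simp

lemma scauchy_convergent_seminorm:
  assumes "scauchy X" shows "(\<lambda>n. seminorm (X n)) \<longlonglongrightarrow> lim (\<lambda>n. seminorm (X n))"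
proof -
  have "Cauchy (\<lambda>n. seminorm (X n))"
    unfolding Cauchy_def dist_real_def
  proof (intro allI impI)
    fix e :: real assume "0 < e"
    from scauchyD[OF assms this]
    show "\<exists>M. \<forall>m\<ge>M. \<forall>n\<ge>M. \<bar>seminorm (X m) - seminorm (X n)\<bar> < e"
      using le_less_trans[OF seminorm_abs_diff] by blast
  qed
  then show ?thesis
    using Cauchy_convergent convergent_LIMSEQ_iff by blast
qed

lemma completion_rel_refl: "completion_rel X X \<longleftrightarrow> scauchy X"
  by (simp add: completion_rel_def)

quotient_type (overloaded) 'v completion = "nat \<Rightarrow> 'v::complex_seminormed_vector" / partial: completion_rel
proof (rule part_equivpI)
  show "\<exists>X. completion_rel X (X :: nat \<Rightarrow> 'v)"
    using completion_rel_refl scauchy_const by blast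
  show "symp (completion_rel :: (nat \<Rightarrow> 'v) \<Rightarrow> _)"
    by (rule sympI) (simp add: completion_rel_def seminorm_minus_commute)
  show "transp (completion_rel :: (nat \<Rightarrow> 'v) \<Rightarrow> _)"
  proof (rule transpI)
    fix X Y Z :: "nat \<Rightarrow> 'v" assume XY: "completion_rel X Y" and YZ: "completion_rel Y Z"
    then have "(\<lambda>n. seminorm (X n - Y n) + seminorm (Y n - Z n)) \<longlonglongrightarrow> 0"
      by (intro tendsto_add_zero) (auto simp: completion_rel_def)
    then have "(\<lambda>n. seminorm (X n - Z n)) \<longlonglongrightarrow> 0"
      by (rule Lim_null_comparison[rotated])
        (simp add: seminorm_nonneg seminorm_diff_triangle)
    with XY YZ show "completion_rel X Z" by (simp add: completion_rel_def)
  qed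
qed

instantiation completion :: (complex_seminormed_vector) complex_vector
begin

lift_definition zero_completion :: "'a completion" is "\<lambda>_. 0"
  by (simp add: completion_rel_refl scauchy_const)

lift_definition plus_completion :: "'a completion \<Rightarrow> 'a completion \<Rightarrow> 'a completion"
  is "\<lambda>X Y n. X n + Y n"
proof -
  fix X X' Y Y' :: "nat \<Rightarrow> 'a" assume a: "completion_rel X X'" "completion_rel Y Y'"
  then have "(\<lambda>n. seminorm (X n - X' n) + seminorm (Y n - Y' n)) \<longlonglongrightarrow> 0"
    by (intro tendsto_add_zero) (auto simp: completion_rel_def)
  then have "(\<lambda>n. seminorm (X n + Y n - (X' n + Y' n))) \<longlonglongrightarrow> 0"
    by (rule Lim_null_comparison[rotated])
      (simp add: seminorm_nonneg add_diff_add seminorm_triangle)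
  with a show "completion_rel (\<lambda>n. X n + Y n) (\<lambda>n. X' n + Y' n)"
    by (simp add: completion_rel_def scauchy_add)
qed

lift_definition scaleC_completion :: "complex \<Rightarrow> 'a completion \<Rightarrow> 'a completion"
  is "\<lambda>c X n. c *\<^sub>C X n"
  by (auto simp: completion_rel_def scauchy_scaleC seminorm_scaleC tendsto_mult_right_zero
      simp flip: scaleC_diff_right)

definition uminus_completion :: "'a completion \<Rightarrow> 'a completion"
  where "uminus_completion x = (- 1) *\<^sub>C x"

definition minus_completion :: "'a completion \<Rightarrow> 'a completion \<Rightarrow> 'a completion"
  where "minus_completion x y = x + - y"

definition scaleR_completion :: "real \<Rightarrow> 'a completion \<Rightarrow> 'a completion"
  where "scaleR_completion r x = complex_of_real r *\<^sub>C x"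

instance
proof
  fix x y z :: "'a completion" and r s :: real and c d :: complex
  show 1: "x + y + z = x + (y + z)" "x + y = y + x" "0 + x = x"
    by (transfer, simp add: completion_rel_refl scauchy_add algebra_simps completion_rel_def)+
  show 2: "c *\<^sub>C (x + y) = c *\<^sub>C x + c *\<^sub>C y" "(c + d) *\<^sub>C x = c *\<^sub>C x + d *\<^sub>C x"
    "c *\<^sub>C d *\<^sub>C x = (c * d) *\<^sub>C x" "1 *\<^sub>C x = x"
    for c d and x y :: "'a completion"
    by (transfer, simp add: completion_rel_def scauchy_add scauchy_scaleC
        scaleC_add_left scaleC_add_right scaleC_scaleC scaleC_one)+
  have z: "0 *\<^sub>C x = 0"
    by transfer (simp add: completion_rel_def scauchy_const)
  show "- x + x = 0"
    using 2(2)[of "-1" 1 x] by (simp add: uminus_completion_def 2 z)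
  show "x - y = x + - y" by (rule minus_completion_def)
  show "r *\<^sub>R (x + y) = r *\<^sub>R x + r *\<^sub>R y" "(r + s) *\<^sub>R x = r *\<^sub>R x + s *\<^sub>R x"
    "r *\<^sub>R s *\<^sub>R x = (r * s) *\<^sub>R x" "1 *\<^sub>R x = x" "r *\<^sub>R x = complex_of_real r *\<^sub>C x"
    by (simp_all add: scaleR_completion_def 2)
qed

end

instantiation completion :: (complex_seminormed_vector) complex_normed_vector
begin

lift_definition norm_completion :: "'a completion \<Rightarrow> real" is "\<lambda>X. lim (\<lambda>n. seminorm (X n))"
proof -
  fix X Y :: "nat \<Rightarrow> 'a" assume a: "completion_rel X Y"
  have "(\<lambda>n. seminorm (X n) - seminorm (Y n)) \<longlonglongrightarrow> 0"
    by (rule Lim_null_comparison[where g="\<lambda>n. seminorm (X n - Y n)"])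
      (use a in \<open>auto simp: completion_rel_def seminorm_abs_diff\<close>)
  moreover have "(\<lambda>n. seminorm (X n) - seminorm (Y n)) \<longlonglongrightarrow> lim (\<lambda>n. seminorm (X n)) - lim (\<lambda>n. seminorm (Y n))"
    using a by (intro tendsto_diff scauchy_convergent_seminorm) (auto simp: completion_rel_def)
  ultimately show "lim (\<lambda>n. seminorm (X n)) = lim (\<lambda>n. seminorm (Y n))"
    using LIMSEQ_unique[of "\<lambda>n. seminorm (X n) - seminorm (Y n)"] by (metis eq_iff_diff_eq_0)
qed

definition dist_completion :: "'a completion \<Rightarrow> 'a completion \<Rightarrow> real"
  where "dist_completion a b = norm (a - b)"

definition
  "(uniformity :: ('a completion \<times> 'a completion) filter) = (INF e\<in>{0 <..}. principal {(x, y). dist x y < e})"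

definition open_completion :: "'a completion set \<Rightarrow> bool"
  where "open_completion S = (\<forall>x\<in>S. \<forall>\<^sub>F (x', y) in uniformity. x' = x \<longrightarrow> y \<in> S)"

definition sgn_completion :: "'a completion \<Rightarrow> 'a completion"
  where "sgn_completion x = scaleR (inverse (norm x)) x"

instance
proof
  fix a b :: "'a completion" and r :: real and c :: complex
  show "sgn a = inverse (norm a) *\<^sub>R a" by (simp add: sgn_completion_def)
  show "dist a b = norm (a - b)" by (simp add: dist_completion_def)
  show "(uniformity :: ('a completion \<times> 'a completion) filter) = (INF e\<in>{0 <..}. principal {(x, y). dist x y < e})"
    by (rule uniformity_completion_def)
  show "open U = (\<forall>x\<in>U. \<forall>\<^sub>F (x', y) in uniformity. x' = x \<longrightarrow> y \<in> U)" for U :: "'a completion set"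
    by (rule open_completion_def)
  show "(norm a = 0) = (a = 0)"
  proof transfer
    fix X :: "nat \<Rightarrow> 'a" assume "completion_rel X X"
    then have X: "scauchy X" by (simp add: completion_rel_refl)
    have *: "completion_rel X (\<lambda>_. 0) \<longleftrightarrow> (\<lambda>n. seminorm (X n)) \<longlonglongrightarrow> 0"
      using X by (simp add: completion_rel_def scauchy_const)
    show "(lim (\<lambda>n. seminorm (X n)) = 0) = completion_rel X (\<lambda>_. 0)"
    proof
      assume "lim (\<lambda>n. seminorm (X n)) = 0"
      with scauchy_convergent_seminorm[OF X] show "completion_rel X (\<lambda>_. 0)"
        unfolding * by (rule back_subst)
    next
      assume "completion_rel X (\<lambda>_. 0)"
      then show "lim (\<lambda>n. seminorm (X n)) = 0" unfolding * by (rule limI)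
    qed
  qed
  show "norm (a + b) \<le> norm a + norm b"
  proof transfer
    fix X Y :: "nat \<Rightarrow> 'a" assume "completion_rel X X" "completion_rel Y Y"
    then have "scauchy X" "scauchy Y" by (simp_all add: completion_rel_refl)
    then show "lim (\<lambda>n. seminorm (X n + Y n)) \<le> lim (\<lambda>n. seminorm (X n)) + lim (\<lambda>n. seminorm (Y n))"
      by (intro LIMSEQ_le[OF scauchy_convergent_seminorm tendsto_add[OF scauchy_convergent_seminorm scauchy_convergent_seminorm]])
        (auto simp: scauchy_add seminorm_triangle)
  qed
  show 1: "norm (c *\<^sub>C a) = cmod c * norm a" for c
  proof transfer
    fix X :: "nat \<Rightarrow> 'a" and c assume "completion_rel X X"
    then have "scauchy X" by (simp add: completion_rel_refl)
    then show "lim (\<lambda>n. seminorm (c *\<^sub>C X n)) = cmod c * lim (\<lambda>n. seminorm (X n))"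
      unfolding seminorm_scaleC by (intro limI tendsto_mult_left scauchy_convergent_seminorm)
  qed
  show "norm (r *\<^sub>R a) = \<bar>r\<bar> * norm a" by (simp add: scaleR_scaleC 1)
qed

end

lift_definition completion_of :: "'v::complex_seminormed_vector \<Rightarrow> 'v completion" is "\<lambda>v _. v"
  by (simp add: completion_rel_refl scauchy_const)

lemma clinear_completion_of: "clinear completion_of"
  unfolding clinear_def
  by (intro conjI allI; transfer) (simp_all add: completion_rel_refl scauchy_const)

lemma norm_completion_of: "norm (completion_of v) = seminorm v"
  by transfer simp

lemma norm_completion_of_diff: "norm (completion_of v - completion_of w) = seminorm (v - w)"
  by (simp add: norm_completion_of flip: clinearD(5)[OF clinear_completion_of])

lemma completion_of_LIMSEQ:
  assumes X: "scauchy X" shows "\<exists>x. (\<lambda>n. completion_of (X n)) \<longlonglongrightarrow> x \<and> x = abs_completion X"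
proof -
  have "norm (completion_of (X k) - abs_completion X) = lim (\<lambda>n. seminorm (X k - X n))" for k
  proof -
    have "completion_of (X k) - abs_completion X = completion_of (X k) + (- 1) *\<^sub>C abs_completion X"
      by (simp add: scaleC_minus1)
    also have "\<dots> = abs_completion (\<lambda>n. X k + (- 1) *\<^sub>C X n)"
      using X by (simp add: completion_of.abs_eq plus_completion.abs_eq scaleC_completion.abs_eq
          eq_onp_same_args completion_rel_refl scauchy_const scauchy_scaleC)
    also have "norm \<dots> = lim (\<lambda>n. seminorm (X k - X n))"
      using X by (subst norm_completion.abs_eq)
        (auto simp: completion_rel_refl scaleC_minus1 intro!: scauchy_diff scauchy_const)
    finally show ?thesis .
  qed
  moreover have "(\<lambda>k. lim (\<lambda>n. seminorm (X k - X n))) \<longlonglongrightarrow> 0"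
  proof (rule LIMSEQ_I)
    fix e :: real assume "0 < e"
    then obtain N where N: "\<forall>m\<ge>N. \<forall>n\<ge>N. seminorm (X m - X n) < e / 2"
      using scauchyD[OF X, of "e / 2"] by auto
    have "norm (lim (\<lambda>n. seminorm (X k - X n)) - 0) < e" if "k \<ge> N" for k
    proof -
      have l: "(\<lambda>n. seminorm (X k - X n)) \<longlonglongrightarrow> lim (\<lambda>n. seminorm (X k - X n))"
        by (intro scauchy_convergent_seminorm scauchy_diff scauchy_const X)
      have "lim (\<lambda>n. seminorm (X k - X n)) \<le> e / 2"
        by (rule LIMSEQ_le_const2[OF l]) (use N that in \<open>auto intro: less_imp_le\<close>)
      moreover have "0 \<le> lim (\<lambda>n. seminorm (X k - X n))"
        by (rule LIMSEQ_le_const[OF l]) (auto simp: seminorm_nonneg)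
      ultimately show ?thesis using \<open>0 < e\<close> by simp
    qed
    then show "\<exists>no. \<forall>n\<ge>no. norm (lim (\<lambda>na. seminorm (X n - X na)) - 0) < e" by blast
  qed
  ultimately have "(\<lambda>k. norm (completion_of (X k) - abs_completion X)) \<longlonglongrightarrow> 0" by simp
  from LIM_zero_cancel[OF tendsto_norm_zero_cancel[OF this]] show ?thesis by simp
qed

lemma completion_of_dense: "\<exists>X. (\<lambda>n. completion_of (X n)) \<longlonglongrightarrow> x"
proof -
  obtain X where "completion_rel X X" "x = abs_completion X"
    using Quotient3_rep_reflp[OF Quotient3_completion] Quotient3_abs_rep[OF Quotient3_completion]
    by (metis (no_types))
  then show ?thesis using completion_of_LIMSEQ completion_rel_refl by blast
qed

instance completion :: (complex_seminormed_vector) complex_banach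
proof
  fix Y :: "nat \<Rightarrow> 'a completion" assume Y: "Cauchy Y"
  have "\<exists>v. norm (completion_of v - Y k) < inverse (real (Suc k))" for k
  proof -
    obtain X where X: "(\<lambda>n. completion_of (X n)) \<longlonglongrightarrow> Y k" using completion_of_dense by blast
    then have "\<exists>n. norm (completion_of (X n) - Y k) < inverse (real (Suc k))"
      using LIMSEQ_D[OF X, of "inverse (real (Suc k))"] by auto
    then show ?thesis by blast
  qed
  then obtain v where v: "norm (completion_of (v k) - Y k) < inverse (real (Suc k))" for k
    by metis
  have 0: "(\<lambda>k. completion_of (v k) - Y k) \<longlonglongrightarrow> 0"
    by (rule Lim_null_comparison[OF _ LIMSEQ_inverse_real_of_nat])
      (intro always_eventually allI less_imp_le v)
  then have Cd: "Cauchy (\<lambda>k. completion_of (v k) - Y k)" by (rule LIMSEQ_imp_Cauchy)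
  have "Cauchy (\<lambda>k. completion_of (v k))"
  proof (rule metric_CauchyI)
    fix e :: real assume "0 < e"
    then obtain M N where M: "\<forall>m\<ge>M. \<forall>n\<ge>M. dist (completion_of (v m) - Y m) (completion_of (v n) - Y n) < e / 2"
      and N: "\<forall>m\<ge>N. \<forall>n\<ge>N. dist (Y m) (Y n) < e / 2"
      using metric_CauchyD[OF Cd, of "e / 2"]
        metric_CauchyD[OF Y, of "e / 2"] by auto
    have "dist (completion_of (v m)) (completion_of (v n)) < e" if "m \<ge> max M N" "n \<ge> max M N" for m n
    proof -
      have "dist (completion_of (v m)) (completion_of (v n))
          \<le> dist (completion_of (v m) - Y m) (completion_of (v n) - Y n) + dist (Y m) (Y n)"
        using norm_triangle_ineq[of "(completion_of (v m) - Y m) - (completion_of (v n) - Y n)" "Y m - Y n"]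
        by (simp add: dist_norm algebra_simps)
      also have "\<dots> < e / 2 + e / 2"
        using M N that by (intro add_strict_mono) auto
      finally show ?thesis by simp
    qed
    then show "\<exists>M. \<forall>m\<ge>M. \<forall>n\<ge>M. dist (completion_of (v m)) (completion_of (v n)) < e" by blast
  qed
  then have "scauchy v"
    unfolding scauchy_def Cauchy_def dist_norm norm_completion_of_diff .
  then obtain x where "(\<lambda>k. completion_of (v k)) \<longlonglongrightarrow> x" using completion_of_LIMSEQ by blast
  from tendsto_diff[OF this 0] show "convergent Y" by (auto simp: convergent_def)
qed

lemma completion_extend:
  fixes f :: "'v::complex_seminormed_vector \<Rightarrow> 'w::complex_banach"
  assumes f: "clinear f" and K: "\<And>v. norm (f v) \<le> K * seminorm v"
  shows "\<exists>L. bounded_clinear L \<and> (\<forall>v. L (completion_of v) = f v) \<and> (\<forall>x. norm (L x) \<le> K * norm x)"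
proof -
  have conv: "\<exists>y. (\<lambda>n. f (X n)) \<longlonglongrightarrow> y" if "(\<lambda>n. completion_of (X n)) \<longlonglongrightarrow> x" for X x
  proof -
    have "Cauchy (\<lambda>n. completion_of (X n))" using that LIMSEQ_imp_Cauchy by blast
    have "Cauchy (\<lambda>n. f (X n))"
      unfolding Cauchy_def
    proof (intro allI impI)
      fix e :: real assume "0 < e"
      then have "e / (\<bar>K\<bar> + 1) > 0" by (simp add: add_nonneg_pos)
      then obtain N where N: "\<forall>m\<ge>N. \<forall>n\<ge>N. seminorm (X m - X n) < e / (\<bar>K\<bar> + 1)"
        using \<open>Cauchy (\<lambda>n. completion_of (X n))\<close>
        unfolding Cauchy_def dist_norm norm_completion_of_diff by blast
      have "dist (f (X m)) (f (X n)) < e" if "m \<ge> N" "n \<ge> N" for m n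
      proof -
        have "dist (f (X m)) (f (X n)) = norm (f (X m - X n))"
          by (simp add: dist_norm clinearD[OF f])
        also have "\<dots> \<le> K * seminorm (X m - X n)" by (rule K)
        also have "\<dots> \<le> (\<bar>K\<bar> + 1) * seminorm (X m - X n)"
          by (intro mult_right_mono seminorm_nonneg) simp
        also have "\<dots> < e" using N that by (simp add: pos_less_divide_eq add_nonneg_pos mult.commute)
        finally show ?thesis .
      qed
      then show "\<exists>M. \<forall>m\<ge>M. \<forall>n\<ge>M. dist (f (X m)) (f (X n)) < e" by blast
    qed
    then show ?thesis using Cauchy_convergent convergent_def by blast
  qed
  have null: "(\<lambda>n. f (X n)) \<longlonglongrightarrow> 0" if "(\<lambda>n. completion_of (X n)) \<longlonglongrightarrow> 0" for X
  proof (rule Lim_null_comparison)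
    show "\<forall>\<^sub>F n in sequentially. norm (f (X n)) \<le> K * norm (completion_of (X n))"
      by (simp add: norm_completion_of K)
    show "(\<lambda>n. K * norm (completion_of (X n))) \<longlonglongrightarrow> 0"
      by (intro tendsto_mult_right_zero tendsto_norm_zero that)
  qed
  define S where "S x = (SOME X. (\<lambda>n. completion_of (X n)) \<longlonglongrightarrow> x)" for x :: "'v completion"
  have S: "(\<lambda>n. completion_of (S x n)) \<longlonglongrightarrow> x" for x
    unfolding S_def using someI_ex[OF completion_of_dense[of x]] .
  define L where "L x = lim (\<lambda>n. f (S x n))" for x
  have LS: "(\<lambda>n. f (S x n)) \<longlonglongrightarrow> L x" for x
    unfolding L_def using conv[OF S[of x]] convergent_LIMSEQ_iff convergent_def by blast
  have L: "(\<lambda>n. f (X n)) \<longlonglongrightarrow> L x" if "(\<lambda>n. completion_of (X n)) \<longlonglongrightarrow> x" for X x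
  proof -
    have "(\<lambda>n. completion_of (X n - S x n)) \<longlonglongrightarrow> 0"
      using tendsto_diff[OF that S[of x]] by (simp add: clinearD[OF clinear_completion_of])
    from tendsto_add[OF null[OF this] LS[of x]] show ?thesis by (simp add: clinearD[OF f])
  qed
  have "clinear L"
    unfolding clinear_def
  proof (intro conjI allI)
    fix x y c
    have "(\<lambda>n. completion_of (S x n + S y n)) \<longlonglongrightarrow> x + y"
      using tendsto_add[OF S S] by (simp add: clinearD[OF clinear_completion_of])
    from L[OF this] tendsto_add[OF LS[of x] LS[of y]] show "L (x + y) = L x + L y"
      by (simp add: clinearD[OF f] LIMSEQ_unique)
    have scale: "(\<lambda>n. c *\<^sub>C Z n) \<longlonglongrightarrow> c *\<^sub>C z" if "Z \<longlonglongrightarrow> z"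
      for Z :: "nat \<Rightarrow> 'z::complex_normed_vector" and z
    proof -
      have "bounded_linear (\<lambda>z::'z. c *\<^sub>C z)"
        by (intro bounded_linear_intro[where K="cmod c"])
          (auto simp: scaleC_add_right scaleR_scaleC scaleC_scaleC norm_scaleC mult.commute)
      then show ?thesis using that by (rule bounded_linear.tendsto)
    qed
    have "(\<lambda>n. completion_of (c *\<^sub>C S x n)) \<longlonglongrightarrow> c *\<^sub>C x"
      using scale[OF S] by (simp add: clinearD[OF clinear_completion_of])
    from L[OF this] scale[OF LS[of x]] show "L (c *\<^sub>C x) = c *\<^sub>C L x"
      by (simp add: clinearD[OF f] LIMSEQ_unique)
  qed
  moreover have K': "norm (L x) \<le> K * norm x" for x
  proof (rule LIMSEQ_le)
    show "(\<lambda>n. norm (f (S x n))) \<longlonglongrightarrow> norm (L x)" by (intro tendsto_norm LS)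
    show "(\<lambda>n. K * norm (completion_of (S x n))) \<longlonglongrightarrow> K * norm x"
      by (intro tendsto_mult_left tendsto_norm S)
    show "\<exists>N. \<forall>n\<ge>N. norm (f (S x n)) \<le> K * norm (completion_of (S x n))"
      by (simp add: norm_completion_of K)
  qed
  moreover have "L (completion_of v) = f v" for v
    using LIMSEQ_unique[OF L[of "\<lambda>_. v" "completion_of v"] tendsto_const] by simp
  ultimately show ?thesis unfolding bounded_clinear_def by blast
qed


subsection \<open>The projective tensor product and its universal property\<close>

type_synonym ('a, 'b) ptensor = "('a, 'b) atensor completion"

definition tensor :: "'a::complex_normed_vector \<Rightarrow> 'b::complex_normed_vector \<Rightarrow> ('a, 'b) ptensor"
    (infixr "\<otimes>\<^sub>p" 70)
  where "a \<otimes>\<^sub>p b = completion_of (formal_sum [(a, b)])"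

text \<open>The bounded linear map corresponding to a bounded bilinear map.\<close>

definition ptensor_lift ::
    "('a::complex_normed_vector \<Rightarrow> 'b::complex_normed_vector \<Rightarrow> 'c::complex_banach) \<Rightarrow> ('a, 'b) ptensor \<Rightarrow> 'c"
  where "ptensor_lift B = (THE L. bounded_clinear L \<and> (\<forall>a b. L (a \<otimes>\<^sub>p b) = B a b))"

lemma clinear_functional_exists:
  assumes "z \<noteq> (0::'a::complex_vector)"
  shows "\<exists>g :: 'a \<Rightarrow> complex. clinear g \<and> g z = 1"
proof -
  interpret vector_space_pair "scaleC :: complex \<Rightarrow> 'a \<Rightarrow> 'a" "scaleC :: complex \<Rightarrow> complex \<Rightarrow> complex"
    by (simp add: vector_space_pair_def scaleC_vector_space)
  have "vs1.independent {z}" using assms by (simp add: vs1.dependent_single)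
  from linear_independent_extend[OF this, of "\<lambda>_. 1"]
  obtain g where g: "Vector_Spaces.linear scaleC scaleC g" "g z = (1::complex)" by auto
  interpret g: Vector_Spaces.linear scaleC scaleC g by (rule g)
  show ?thesis using g(2) g.add g.scale by (auto simp: clinear_def)
qed

lemma formal_sum_bilinear:
  fixes B :: "'a::complex_vector \<Rightarrow> 'b::complex_vector \<Rightarrow> 'c::complex_vector"
  assumes B: "cbilinear B" and eq: "formal_sum xs = formal_sum ys"
  shows "(\<Sum>(a, b)\<leftarrow>xs. B a b) = (\<Sum>(a, b)\<leftarrow>ys. B a b)"
proof (rule ccontr)
  assume "\<not> ?thesis"
  then obtain g :: "'c \<Rightarrow> complex" where g: "clinear g"
      "g ((\<Sum>(a, b)\<leftarrow>xs. B a b) - (\<Sum>(a, b)\<leftarrow>ys. B a b)) = 1"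
    using clinear_functional_exists by (metis eq_iff_diff_eq_0)
  have "cbilinear (\<lambda>a b. g (B a b))"
    using B g(1) by (auto simp: cbilinear_def clinear_def)
  moreover have "tensor_eval xs = tensor_eval ys" using eq by transfer
  moreover have "g (\<Sum>(a, b)\<leftarrow>zs. B a b) = (\<Sum>(a, b)\<leftarrow>zs. g (B a b))" for zs
    by (induction zs) (auto simp: clinearD[OF g(1)])
  ultimately have "g (\<Sum>(a, b)\<leftarrow>xs. B a b) = g (\<Sum>(a, b)\<leftarrow>ys. B a b)"
    by (metis tensor_eval_def)
  with g show False by (simp add: clinearD[OF g(1)])
qed

lemma norm_tensor_le: "norm (a \<otimes>\<^sub>p b) \<le> norm a * norm b"
  using seminorm_atensor_le[of "[(a, b)]"]
  by (simp add: tensor_def norm_completion_of formal_cost_def)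

lemma cbilinear_tensor: "cbilinear (\<otimes>\<^sub>p)"
proof -
  have add1: "formal_sum [(a + a', b)] = formal_sum [(a, b)] + formal_sum [(a', b)]"
    and add2: "formal_sum [(a, b + b')] = formal_sum [(a, b)] + formal_sum [(a, b')]"
    and scale1: "formal_sum [(c *\<^sub>C a, b)] = c *\<^sub>C formal_sum [(a, b)]"
    and scale2: "formal_sum [(a, c *\<^sub>C b)] = c *\<^sub>C formal_sum [(a, b)]" for a a' :: 'a and b b' :: 'b and c
    by (transfer, auto simp: tensor_eval_def fun_eq_iff cbilinear_def clinear_def scaleC_complex_def)+
  show ?thesis
    unfolding cbilinear_def clinear_def tensor_def add1 add2 scale1 scale2
    by (simp add: clinearD[OF clinear_completion_of])
qed

lemma bounded_cbilinear_tensor: "bounded_cbilinear (\<otimes>\<^sub>p)"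
  unfolding bounded_cbilinear_def using cbilinear_tensor norm_tensor_le
  by (metis mult_1)

lemma ptensor_eqI:
  fixes L M :: "('a::complex_normed_vector, 'b::complex_normed_vector) ptensor \<Rightarrow> 'c::complex_normed_vector"
  assumes L: "bounded_clinear L" and M: "bounded_clinear M"
    and eq: "\<And>a b. L (a \<otimes>\<^sub>p b) = M (a \<otimes>\<^sub>p b)"
  shows "L = M"
proof
  fix u :: "('a, 'b) ptensor"
  have cl: "clinear L" "clinear M" using L M by (auto simp: bounded_clinear_def)
  have "L (completion_of (formal_sum xs)) = M (completion_of (formal_sum xs))" for xs
  proof (induction xs)
    case Nil
    show ?case
      by (simp add: formal_sum_simps clinearD[OF clinear_completion_of] clinearD[OF cl(1)] clinearD[OF cl(2)])
  next
    case (Cons x xs)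
    then show ?case
      using eq[of "fst x" "snd x"] unfolding formal_sum_Cons[of x xs]
      by (simp add: tensor_def clinearD[OF clinear_completion_of] clinearD[OF cl(1)] clinearD[OF cl(2)])
  qed
  then have *: "L (completion_of v) = M (completion_of v)" for v
    using formal_sum_surj[of v] by auto
  obtain X :: "nat \<Rightarrow> ('a, 'b) atensor" where X: "(\<lambda>n. completion_of (X n)) \<longlonglongrightarrow> u" using completion_of_dense by blast
  have "(\<lambda>n. L (completion_of (X n))) \<longlonglongrightarrow> L u"
    by (rule bounded_linear.tendsto[OF bounded_clinear_imp_bounded_linear[OF L] X])
  moreover have "(\<lambda>n. M (completion_of (X n))) \<longlonglongrightarrow> M u"
    by (rule bounded_linear.tendsto[OF bounded_clinear_imp_bounded_linear[OF M] X])
  ultimately show "L u = M u" unfolding * by (rule LIMSEQ_unique)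
qed

lemma ptensor_universal:
  fixes B :: "'a::complex_normed_vector \<Rightarrow> 'b::complex_normed_vector \<Rightarrow> 'c::complex_banach"
  assumes B: "cbilinear B" and K: "\<And>a b. norm (B a b) \<le> K * norm a * norm b" and "0 \<le> K"
  shows "\<exists>L. bounded_clinear L \<and> (\<forall>a b. L (a \<otimes>\<^sub>p b) = B a b) \<and> (\<forall>u. norm (L u) \<le> K * norm u)"
proof -
  define r where "r u = (SOME xs :: ('a \<times> 'b) list. formal_sum xs = u)" for u
  have r: "formal_sum (r u) = u" for u
    unfolding r_def by (rule someI_ex) (metis formal_sum_surj)
  define f where "f u = (\<Sum>(a, b)\<leftarrow>r u. B a b)" for u
  have f: "f (formal_sum xs) = (\<Sum>(a, b)\<leftarrow>xs. B a b)" for xs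
    unfolding f_def by (rule formal_sum_bilinear[OF B r])
  have "clinear f"
    unfolding clinear_def
  proof (intro conjI allI)
    fix u v c
    have "f (formal_sum (r u @ r v)) = f u + f v" unfolding f by (simp add: f_def)
    then show "f (u + v) = f u + f v" by (simp add: formal_sum_simps r)
    have "clinear (\<lambda>a. B a b)" for b using B by (simp add: cbilinear_def)
    then have "(\<Sum>(a, b)\<leftarrow>map (\<lambda>(a, b). (c *\<^sub>C a, b)) xs. B a b) = c *\<^sub>C (\<Sum>(a, b)\<leftarrow>xs. B a b)" for xs
      by (induction xs) (auto simp: scaleC_add_right clinear_def)
    then have "f (formal_sum (map (\<lambda>(a, b). (c *\<^sub>C a, b)) (r u))) = c *\<^sub>C f u"
      unfolding f by (simp add: f_def)
    then show "f (c *\<^sub>C u) = c *\<^sub>C f u" by (simp add: formal_sum_simps r)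
  qed
  moreover have "norm (f u) \<le> K * seminorm u" for u
  proof (cases "K = 0")
    case True
    then have "norm (\<Sum>(a, b)\<leftarrow>xs. B a b) \<le> 0" for xs
      using K by (induction xs) auto
    then have "f u = 0" unfolding f_def by (metis norm_le_zero_iff)
    with True show ?thesis by simp
  next
    case False
    have "norm (f u) / K \<le> seminorm u"
    proof (rule seminorm_atensor_ge)
      fix xs :: "('a \<times> 'b) list" assume "formal_sum xs = u"
      then have "f u = (\<Sum>(a, b)\<leftarrow>xs. B a b)" using f by blast
      moreover have "norm (\<Sum>(a, b)\<leftarrow>xs. B a b) \<le> K * formal_cost xs"
      proof (induction xs)
        case (Cons x xs)
        show ?case
          using norm_triangle_le[OF add_mono[OF K Cons], of "fst x" "snd x"]
          by (simp add: formal_cost_def algebra_simps split_beta)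
      qed (simp add: formal_cost_def)
      ultimately show "norm (f u) / K \<le> formal_cost xs"
        using False \<open>0 \<le> K\<close> by (simp add: divide_le_eq mult.commute)
    qed
    with False \<open>0 \<le> K\<close> show ?thesis by (simp add: divide_le_eq mult.commute)
  qed
  ultimately obtain L where "bounded_clinear L" "\<forall>v. L (completion_of v) = f v"
      "\<forall>x. norm (L x) \<le> K * norm x"
    using completion_extend by blast
  then show ?thesis by (intro exI[of _ L]) (simp add: tensor_def f)
qed

lemma bounded_cbilinear_bound:
  assumes "bounded_cbilinear B"
  obtains K where "0 \<le> K" "\<And>x y. norm (B x y) \<le> K * norm x * norm y"
proof -
  obtain K where K: "\<And>x y. norm (B x y) \<le> K * norm x * norm y"
    using assms by (auto simp: bounded_cbilinear_def)
  have "norm (B x y) \<le> \<bar>K\<bar> * norm x * norm y" for x y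
    by (rule order_trans[OF K]) (intro mult_right_mono; simp)
  then show ?thesis using that[of "\<bar>K\<bar>"] by simp
qed

lemma ptensor_lift:
  assumes "bounded_cbilinear B"
  shows "bounded_clinear (ptensor_lift B)" "ptensor_lift B (a \<otimes>\<^sub>p b) = B a b"
proof -
  obtain K where "0 \<le> K" "\<And>x y. norm (B x y) \<le> K * norm x * norm y"
    using bounded_cbilinear_bound[OF assms] by blast
  then obtain L where "bounded_clinear L \<and> (\<forall>a b. L (a \<otimes>\<^sub>p b) = B a b)"
    using ptensor_universal[of B K] assms by (auto simp: bounded_cbilinear_def)
  then have "\<exists>!L. bounded_clinear L \<and> (\<forall>a b. L (a \<otimes>\<^sub>p b) = B a b)"
    by (auto intro!: ex1I[of _ L] ptensor_eqI)
  from theI'[OF this] show "bounded_clinear (ptensor_lift B)" "ptensor_lift B (a \<otimes>\<^sub>p b) = B a b"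
    by (auto simp: ptensor_lift_def)
qed

lemma ptensor_lift_unique:
  "bounded_clinear L \<Longrightarrow> (\<And>a b. L (a \<otimes>\<^sub>p b) = B a b) \<Longrightarrow> bounded_cbilinear B \<Longrightarrow> ptensor_lift B = L"
  by (rule ptensor_eqI) (simp_all add: ptensor_lift)

lemma norm_ptensor_lift:
  assumes B: "bounded_cbilinear B" and K: "0 \<le> K" "\<And>x y. norm (B x y) \<le> K * norm x * norm y"
  shows "norm (ptensor_lift B u) \<le> K * norm u"
proof -
  obtain L where "bounded_clinear L" "\<forall>a b. L (a \<otimes>\<^sub>p b) = B a b" "\<forall>u. norm (L u) \<le> K * norm u"
    using ptensor_universal[OF _ K(2,1)] B by (auto simp: bounded_cbilinear_def)
  then show ?thesis using ptensor_lift_unique[of L B] B by auto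
qed


section \<open>Banach bimodules\<close>

text \<open>A Banach bimodule is given by its left and right actions, \<^term>\<open>lm a x\<close> and \<^term>\<open>rm x a\<close>.\<close>

definition banach_bimodule ::
    "('a::complex_banach_algebra \<Rightarrow> 'e::complex_banach \<Rightarrow> 'e) \<Rightarrow> ('e \<Rightarrow> 'a \<Rightarrow> 'e) \<Rightarrow> bool"
  where "banach_bimodule lm rm \<longleftrightarrow>
    bounded_cbilinear lm \<and> bounded_cbilinear rm \<and>
    (\<forall>a b x. lm (a * b) x = lm a (lm b x)) \<and>
    (\<forall>a b x. rm x (a * b) = rm (rm x a) b) \<and>
    (\<forall>a b x. lm a (rm x b) = rm (lm a x) b)"

definition dual_left :: "('e::complex_banach \<Rightarrow> 'a \<Rightarrow> 'e) \<Rightarrow> 'a \<Rightarrow> 'e cdual \<Rightarrow> 'e cdual"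
  where "dual_left rm a f = CDual (\<lambda>x. cdual_apply f (rm x a))"

definition dual_right :: "('a \<Rightarrow> 'e::complex_banach \<Rightarrow> 'e) \<Rightarrow> 'e cdual \<Rightarrow> 'a \<Rightarrow> 'e cdual"
  where "dual_right lm f a = CDual (\<lambda>x. cdual_apply f (lm a x))"

definition ptensor_left ::
    "'a::complex_banach_algebra \<Rightarrow> ('a, 'a) ptensor \<Rightarrow> ('a, 'a) ptensor"
  where "ptensor_left a = ptensor_lift (\<lambda>b c. (a * b) \<otimes>\<^sub>p c)"

definition ptensor_right ::
    "('a, 'a) ptensor \<Rightarrow> 'a::complex_banach_algebra \<Rightarrow> ('a, 'a) ptensor"
  where "ptensor_right u a = ptensor_lift (\<lambda>b c. b \<otimes>\<^sub>p (c * a)) u"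

lemma bounded_clinear_compose:
  assumes f: "bounded_clinear f" and g: "bounded_clinear g"
  shows "bounded_clinear (\<lambda>x. f (g x))"
  using bounded_linear_compose[of f g] assms by (auto simp: bounded_clinear_iff)

lemma bounded_clinear_plus:
  assumes f: "bounded_clinear f" and g: "bounded_clinear g"
  shows "bounded_clinear (\<lambda>x. f x + g x)"
  using bounded_linear_add[of f g] assms by (auto simp: bounded_clinear_iff scaleC_add_right)

lemma bounded_clinear_scaleC:
  assumes f: "bounded_clinear f" shows "bounded_clinear (\<lambda>x. c *\<^sub>C f x)"
proof -
  have "bounded_linear (\<lambda>z::'b. c *\<^sub>C z)"
    by (intro bounded_linear_intro[where K="cmod c"])
      (auto simp: scaleC_add_right scaleR_scaleC scaleC_scaleC norm_scaleC mult.commute)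
  from bounded_linear_compose[OF this, of f] f show ?thesis
    by (auto simp: bounded_clinear_iff scaleC_scaleC mult.commute)
qed

lemma bounded_cbilinear_partial:
  assumes "bounded_cbilinear B"
  shows "bounded_clinear (B x)" "bounded_clinear (\<lambda>x. B x y)"
proof -
  obtain K where "\<And>x y. norm (B x y) \<le> K * norm x * norm y"
    using assms by (auto simp: bounded_cbilinear_def)
  then have "norm (B x y) \<le> (K * norm x) * norm y" "norm (B x y) \<le> (K * norm y) * norm x" for x y
    by (simp_all add: mult.commute mult.left_commute)
  then show "bounded_clinear (B x)" "bounded_clinear (\<lambda>x. B x y)"
    using assms unfolding bounded_clinear_def bounded_cbilinear_def cbilinear_def by fast+
qed

lemma bounded_cbilinearI:
  assumes "\<And>x. clinear (B x)" "\<And>y. clinear (\<lambda>x. B x y)" "\<And>x y. norm (B x y) \<le> K * norm x * norm y"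
  shows "bounded_cbilinear B"
  using assms by (auto simp: bounded_cbilinear_def cbilinear_def)

lemma bounded_cbilinear_mult: "bounded_cbilinear ((*) :: 'a \<Rightarrow> 'a \<Rightarrow> 'a::complex_banach_algebra)"
  by (rule bounded_cbilinearI[where K=1])
    (auto simp: clinear_def scaleC_mult_left scaleC_mult_right algebra_simps norm_mult_ineq)

lemma banach_bimodule_mult: "banach_bimodule (*) ((*) :: 'a \<Rightarrow> 'a \<Rightarrow> 'a::complex_banach_algebra)"
  by (simp add: banach_bimodule_def bounded_cbilinear_mult mult.assoc)

lemma cdual_apply_dual_left:
  "banach_bimodule lm rm \<Longrightarrow> cdual_apply (dual_left rm a f) x = cdual_apply f (rm x a)"
  unfolding dual_left_def banach_bimodule_def
  by (subst cdual_apply_CDual)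
    (auto intro: bounded_clinear_compose[OF cdual_apply_bounded_clinear] bounded_cbilinear_partial)

lemma cdual_apply_dual_right:
  "banach_bimodule lm rm \<Longrightarrow> cdual_apply (dual_right lm f a) x = cdual_apply f (lm a x)"
  unfolding dual_right_def banach_bimodule_def
  by (subst cdual_apply_CDual)
    (auto intro: bounded_clinear_compose[OF cdual_apply_bounded_clinear] bounded_cbilinear_partial)

lemma banach_bimodule_dual:
  assumes bm: "banach_bimodule lm rm"
  shows "banach_bimodule (dual_left rm) (dual_right lm)"
proof -
  note ap = cdual_apply_dual_left[OF bm] cdual_apply_dual_right[OF bm]
  have cl: "clinear (cdual_apply f)" for f :: "'b cdual"
    using cdual_apply_bounded_clinear by (auto simp: bounded_clinear_def)
  have lin: "\<And>a. clinear (lm a)" "\<And>x. clinear (\<lambda>a. lm a x)" "\<And>x. clinear (rm x)" "\<And>a. clinear (\<lambda>x. rm x a)"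
    using bm by (auto simp: banach_bimodule_def bounded_cbilinear_def cbilinear_def)
  obtain K where K: "0 \<le> K" "\<And>x y. norm (lm x y) \<le> K * norm x * norm y"
    using bm bounded_cbilinear_bound unfolding banach_bimodule_def by blast
  obtain K' where K': "0 \<le> K'" "\<And>x y. norm (rm x y) \<le> K' * norm x * norm y"
    using bm bounded_cbilinear_bound unfolding banach_bimodule_def by blast
  have "bounded_cbilinear (dual_left rm)"
  proof (rule bounded_cbilinearI)
    show "clinear (dual_left rm a)" for a
      by (auto simp: clinear_def ap intro!: cdual_eqI)
    show "clinear (\<lambda>a. dual_left rm a f)" for f
      using lin(3) by (auto simp: clinear_def ap clinearD[OF cl] scaleC_complex_def intro!: cdual_eqI)
    show "norm (dual_left rm a f) \<le> K' * norm a * norm f" for a f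
    proof (rule norm_cdual_bound)
      fix x
      have "cmod (cdual_apply (dual_left rm a f) x) \<le> norm f * (K' * norm x * norm a)"
        unfolding ap by (rule order_trans[OF norm_cdual_apply]) (intro mult_left_mono K'; simp)
      then show "cmod (cdual_apply (dual_left rm a f) x) \<le> K' * norm a * norm f * norm x"
        by (simp add: algebra_simps)
    qed (simp add: K')
  qed
  moreover have "bounded_cbilinear (dual_right lm)"
  proof (rule bounded_cbilinearI)
    show "clinear (dual_right lm f)" for f
      using lin(2) by (auto simp: clinear_def ap clinearD[OF cl] scaleC_complex_def intro!: cdual_eqI)
    show "clinear (\<lambda>f. dual_right lm f a)" for a
      by (auto simp: clinear_def ap intro!: cdual_eqI)
    show "norm (dual_right lm f a) \<le> K * norm f * norm a" for a f
    proof (rule norm_cdual_bound)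
      fix x
      have "cmod (cdual_apply (dual_right lm f a) x) \<le> norm f * (K * norm a * norm x)"
        unfolding ap by (rule order_trans[OF norm_cdual_apply]) (intro mult_left_mono K; simp)
      then show "cmod (cdual_apply (dual_right lm f a) x) \<le> K * norm f * norm a * norm x"
        by (simp add: algebra_simps)
    qed (simp add: K)
  qed
  ultimately show ?thesis
    using bm by (auto simp: banach_bimodule_def ap intro!: cdual_eqI)
qed

lemma bounded_cbilinear_tensor_left: "bounded_cbilinear (\<lambda>b (c::'a). (a * b) \<otimes>\<^sub>p c)"
  and bounded_cbilinear_tensor_right: "bounded_cbilinear (\<lambda>(b::'a) c. b \<otimes>\<^sub>p (c * a))"
  and norm_tensor_left: "norm ((a * b) \<otimes>\<^sub>p c) \<le> norm a * norm b * norm c"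
  and norm_tensor_right: "norm (b \<otimes>\<^sub>p (c * a)) \<le> norm a * norm b * norm c"
  for a b c :: "'a::complex_banach_algebra"
proof -
  show 1: "norm ((a * b) \<otimes>\<^sub>p c) \<le> norm a * norm b * norm c" for b c
    by (rule order_trans[OF norm_tensor_le]) (intro mult_right_mono norm_mult_ineq; simp)
  show 2: "norm (b \<otimes>\<^sub>p (c * a)) \<le> norm a * norm b * norm c" for b c
    using order_trans[OF norm_tensor_le[of b "c * a"] mult_left_mono[OF norm_mult_ineq[of c a]]]
    by (simp add: mult.commute mult.left_commute)
  have t: "clinear ((\<otimes>\<^sub>p) x)" "clinear (\<lambda>z::'a. z \<otimes>\<^sub>p y)" for x y :: 'a
    using cbilinear_tensor by (auto simp: cbilinear_def)
  note t1 = t(1)[THEN clinearD(1)] t(2)[THEN clinearD(1)] t(1)[THEN clinearD(2)] t(2)[THEN clinearD(2)]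
  show "bounded_cbilinear (\<lambda>b (c::'a). (a * b) \<otimes>\<^sub>p c)"
    by (rule bounded_cbilinearI[where K="norm a", OF _ _ 1])
      (auto simp: clinear_def t1 scaleC_mult_right distrib_left)
  show "bounded_cbilinear (\<lambda>(b::'a) c. b \<otimes>\<^sub>p (c * a))"
    by (rule bounded_cbilinearI[where K="norm a", OF _ _ 2])
      (auto simp: clinear_def t1 scaleC_mult_left distrib_right)
qed

lemma ptensor_left: "bounded_clinear (ptensor_left a)" "ptensor_left a (b \<otimes>\<^sub>p c) = (a * b) \<otimes>\<^sub>p c"
  and ptensor_right: "bounded_clinear (\<lambda>u. ptensor_right u a)" "ptensor_right (b \<otimes>\<^sub>p c) a = b \<otimes>\<^sub>p (c * a)"
  unfolding ptensor_left_def ptensor_right_def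
  by (simp_all add: ptensor_lift bounded_cbilinear_tensor_left bounded_cbilinear_tensor_right)

lemma norm_ptensor_left: "norm (ptensor_left a u) \<le> norm a * norm u"
  unfolding ptensor_left_def
  by (rule norm_ptensor_lift[OF bounded_cbilinear_tensor_left _ norm_tensor_left]) simp

lemma norm_ptensor_right: "norm (ptensor_right u a) \<le> norm a * norm u"
  unfolding ptensor_right_def
  by (rule norm_ptensor_lift[OF bounded_cbilinear_tensor_right _ norm_tensor_right]) simp

lemma banach_bimodule_ptensor:
  "banach_bimodule (ptensor_left :: 'a \<Rightarrow> _) (ptensor_right :: _ \<Rightarrow> 'a::complex_banach_algebra \<Rightarrow> _)"
proof -
  have t: "clinear ((\<otimes>\<^sub>p) x)" "clinear (\<lambda>z::'a. z \<otimes>\<^sub>p y)" for x y :: 'a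
    using cbilinear_tensor by (auto simp: cbilinear_def)
  note t1 = t(1)[THEN clinearD(1)] t(2)[THEN clinearD(1)] t(1)[THEN clinearD(2)] t(2)[THEN clinearD(2)]
  have "bounded_cbilinear (ptensor_left :: 'a \<Rightarrow> _)"
  proof (rule bounded_cbilinearI[where K=1])
    show "clinear (ptensor_left a)" for a :: 'a using ptensor_left(1)[of a] by (simp add: bounded_clinear_def)
    show "clinear (\<lambda>a. ptensor_left a u)" for u :: "('a, 'a) ptensor"
      unfolding clinear_def
    proof (intro conjI allI)
      fix a b :: 'a and c
      have "ptensor_left (a + b) = (\<lambda>u. ptensor_left a u + ptensor_left b u)"
        by (rule ptensor_eqI) (auto simp: ptensor_left t1 distrib_right intro!: bounded_clinear_plus)
      then show "ptensor_left (a + b) u = ptensor_left a u + ptensor_left b u" by simp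
      have "ptensor_left (c *\<^sub>C a) = (\<lambda>u. c *\<^sub>C ptensor_left a u)"
        by (rule ptensor_eqI) (auto simp: ptensor_left t1 scaleC_mult_left intro!: bounded_clinear_scaleC)
      then show "ptensor_left (c *\<^sub>C a) u = c *\<^sub>C ptensor_left a u" by simp
    qed
  qed (simp add: norm_ptensor_left)
  moreover have "bounded_cbilinear (ptensor_right :: _ \<Rightarrow> 'a \<Rightarrow> _)"
  proof (rule bounded_cbilinearI[where K=1])
    show "clinear (\<lambda>u. ptensor_right u a)" for a :: 'a using ptensor_right(1)[of a] by (simp add: bounded_clinear_def)
    show "clinear (ptensor_right u)" for u :: "('a, 'a) ptensor"
      unfolding clinear_def
    proof (intro conjI allI)
      fix a b :: 'a and c
      have "(\<lambda>u. ptensor_right u (a + b)) = (\<lambda>u. ptensor_right u a + ptensor_right u b)"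
        by (rule ptensor_eqI) (auto simp: ptensor_right t1 distrib_left intro!: bounded_clinear_plus)
      from fun_cong[OF this] show "ptensor_right u (a + b) = ptensor_right u a + ptensor_right u b" .
      have "(\<lambda>u. ptensor_right u (c *\<^sub>C a)) = (\<lambda>u. c *\<^sub>C ptensor_right u a)"
        by (rule ptensor_eqI) (auto simp: ptensor_right t1 scaleC_mult_right intro!: bounded_clinear_scaleC)
      from fun_cong[OF this] show "ptensor_right u (c *\<^sub>C a) = c *\<^sub>C ptensor_right u a" .
    qed
  qed (use norm_ptensor_right in \<open>simp add: mult.commute\<close>)
  moreover have "ptensor_left (a * b) u = ptensor_left a (ptensor_left b u)" for a b :: 'a and u
  proof -
    have "ptensor_left (a * b) = (\<lambda>u. ptensor_left a (ptensor_left b u))"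
      by (rule ptensor_eqI)
        (auto simp: ptensor_left mult.assoc intro: bounded_clinear_compose[OF ptensor_left(1) ptensor_left(1)])
    from fun_cong[OF this] show ?thesis .
  qed
  moreover have "ptensor_right u (a * b) = ptensor_right (ptensor_right u a) b" for a b :: 'a and u
  proof -
    have "(\<lambda>u. ptensor_right u (a * b)) = (\<lambda>u. ptensor_right (ptensor_right u a) b)"
      by (rule ptensor_eqI)
        (auto simp: ptensor_right mult.assoc intro: bounded_clinear_compose[OF ptensor_right(1) ptensor_right(1)])
    from fun_cong[OF this] show ?thesis .
  qed
  moreover have "ptensor_left a (ptensor_right u b) = ptensor_right (ptensor_left a u) b" for a b :: 'a and u
  proof -
    have "(\<lambda>u. ptensor_left a (ptensor_right u b)) = (\<lambda>u. ptensor_right (ptensor_left a u) b)"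
      by (rule ptensor_eqI)
        (auto simp: ptensor_right ptensor_left
          intro: bounded_clinear_compose[OF ptensor_left(1) ptensor_right(1)]
            bounded_clinear_compose[OF ptensor_right(1) ptensor_left(1)])
    from fun_cong[OF this] show ?thesis .
  qed
  ultimately show ?thesis unfolding banach_bimodule_def by simp
qed


section \<open>Dual Banach algebras and Connes amenability\<close>

definition initial_topology :: "('x \<Rightarrow> complex) set \<Rightarrow> 'x topology"
  where "initial_topology F = topology_generated_by {f -` U |f U. f \<in> F \<and> open U}"

definition weak_topology :: "'e::complex_banach topology"
  where "weak_topology = initial_topology (range cdual_apply)"

definition wkstar_topology :: "'a::complex_banach cdual set \<Rightarrow> 'a topology"
  where "wkstar_topology P = initial_topology (cdual_apply ` P)"

text \<open>
  \<^term>\<open>P\<close> is the predual: the last two conjuncts say that evaluation is an isometry of the algebra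
  onto the dual space of \<^term>\<open>P\<close>.
\<close>

definition dual_banach_algebra :: "'a::complex_banach_algebra cdual set \<Rightarrow> bool"
  where "dual_banach_algebra P \<longleftrightarrow>
    csubspace P \<and> closed P \<and>
    (\<forall>f\<in>P. \<forall>a. dual_left (*) a f \<in> P \<and> dual_right (*) f a \<in> P) \<and>
    (\<forall>a. norm a = (SUP f\<in>{f \<in> P. norm f \<le> 1}. cmod (cdual_apply f a))) \<and>
    (\<forall>m. bounded_clinear_on P m \<longrightarrow> (\<exists>a. \<forall>f\<in>P. m f = cdual_apply f a))"

definition wkstar_characters :: "'a::complex_banach_algebra cdual set \<Rightarrow> ('a \<Rightarrow> complex) set"
  where "wkstar_characters P =
    {\<phi>. clinear \<phi> \<and> (\<forall>a b. \<phi> (a * b) = \<phi> a * \<phi> b) \<and> (\<exists>a. \<phi> a \<noteq> 0) \<and>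
        continuous_map (wkstar_topology P) euclidean \<phi>}"

definition sigma_wc ::
    "'a::complex_banach_algebra cdual set \<Rightarrow> ('a \<Rightarrow> 'e::complex_banach \<Rightarrow> 'e) \<Rightarrow> ('e \<Rightarrow> 'a \<Rightarrow> 'e) \<Rightarrow> 'e set"
  where "sigma_wc P lm rm =
    {x. continuous_map (wkstar_topology P) weak_topology (\<lambda>a. lm a x) \<and>
        continuous_map (wkstar_topology P) weak_topology (\<lambda>a. rm x a)}"

definition sigma_wc_dual :: "'a::complex_banach_algebra cdual set \<Rightarrow> 'a cdual set"
  where "sigma_wc_dual P = sigma_wc P (dual_left (*)) (dual_right (*))"

definition sigma_wc_ptensor_dual :: "'a::complex_banach_algebra cdual set \<Rightarrow> ('a, 'a) ptensor cdual set"
  where "sigma_wc_ptensor_dual P = sigma_wc P (dual_left ptensor_right) (dual_right ptensor_left)"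

definition Connes_amenable :: "'a::complex_banach_algebra cdual set \<Rightarrow> ('a \<Rightarrow> complex) \<Rightarrow> bool"
  where "Connes_amenable P \<phi> \<longleftrightarrow>
    (\<exists>m. bounded_clinear_on (sigma_wc_dual P) m \<and> m (CDual \<phi>) = 1 \<and>
      (\<forall>a. \<forall>f\<in>sigma_wc_dual P. m (dual_right (*) f a) = \<phi> a * m f))"

definition tensor_functional ::
    "('a::complex_banach_algebra \<Rightarrow> complex) \<Rightarrow> ('a \<Rightarrow> complex) \<Rightarrow> ('a, 'a) ptensor cdual"
  where "tensor_functional \<phi> \<psi> = CDual (ptensor_lift (\<lambda>a b. \<phi> a * \<psi> b))"

lemma openin_wkstar_topology_imp_open:
  assumes "openin (wkstar_topology P) S" shows "open S"
proof -
  have "generate_topology_on {f -` U |f U. f \<in> cdual_apply ` P \<and> open U} S"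
    using assms by (simp add: wkstar_topology_def initial_topology_def openin_topology_generated_by_iff)
  then show ?thesis
  proof induction
    case (Basis s)
    then obtain f :: "'a cdual" and U where "s = cdual_apply f -` U" "open U" by blast
    moreover have "continuous_on UNIV (cdual_apply f)"
      using bounded_clinear_imp_bounded_linear[OF cdual_apply_bounded_clinear]
      by (rule linear_continuous_on)
    ultimately show ?case by (simp add: open_vimage)
  qed auto
qed

lemma topspace_wkstar_topology:
  assumes "dual_banach_algebra P" shows "topspace (wkstar_topology P) = UNIV"
proof -
  have "0 \<in> P" using assms by (simp add: dual_banach_algebra_def csubspace_def)
  then have "UNIV \<in> {f -` U |f U. f \<in> cdual_apply ` P \<and> open U}"
    by (intro CollectI exI[of _ "cdual_apply 0"] exI[of _ UNIV]) simp
  from Union_upper[OF this] show ?thesis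
    unfolding wkstar_topology_def initial_topology_def topology_generated_by_topspace
    by (rule top.extremum_uniqueI)
qed

lemma wkstar_character_bounded:
  assumes P: "dual_banach_algebra P" and phi: "\<phi> \<in> wkstar_characters P"
  shows "bounded_clinear \<phi>"
proof -
  have cl: "clinear \<phi>" and cm: "continuous_map (wkstar_topology P) euclidean \<phi>"
    using phi by (auto simp: wkstar_characters_def)
  have "openin (wkstar_topology P) {x \<in> topspace (wkstar_topology P). \<phi> x \<in> ball 0 1}"
    using cm by (rule openin_continuous_map_preimage) simp
  then have "open {x. \<phi> x \<in> ball 0 1}"
    using openin_wkstar_topology_imp_open by (simp add: topspace_wkstar_topology[OF P])
  moreover have "0 \<in> {x. \<phi> x \<in> ball 0 1}" by (simp add: clinearD[OF cl])
  ultimately obtain e where e: "0 < e" "cball 0 e \<subseteq> {x. \<phi> x \<in> ball 0 1}"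
    using open_contains_cball by blast
  have "cmod (\<phi> x) \<le> (1 / e) * norm x" for x
  proof (cases "x = 0")
    case False
    have "(e / norm x) *\<^sub>R x \<in> cball 0 e" using e(1) False by simp
    with e(2) have "\<phi> ((e / norm x) *\<^sub>R x) \<in> ball 0 1" by blast
    then have "cmod (\<phi> ((e / norm x) *\<^sub>R x)) < 1" by simp
    then have "e / norm x * cmod (\<phi> x) < 1"
      using e(1) by (simp add: clinearD[OF cl])
    then show ?thesis using e(1) False by (simp add: field_simps)
  qed (simp add: clinearD[OF cl])
  with cl show ?thesis unfolding bounded_clinear_def by blast
qed

lemma cdual_apply_tensor_functional:
  assumes "bounded_clinear \<phi>" "bounded_clinear \<psi>"
  shows "cdual_apply (tensor_functional \<phi> \<psi>) (a \<otimes>\<^sub>p b) = \<phi> a * \<psi> b"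
proof -
  obtain K L where "\<And>x. norm (\<phi> x) \<le> K * norm x" "\<And>x. norm (\<psi> x) \<le> L * norm x"
    using assms unfolding bounded_clinear_def by blast
  then have *: "cmod (\<phi> x * \<psi> y) \<le> (K * L) * norm x * norm y" for x y
    using mult_mono'[of "cmod (\<phi> x)" "K * norm x" "cmod (\<psi> y)" "L * norm y"]
    by (simp add: norm_mult algebra_simps)
  have "bounded_cbilinear (\<lambda>a b. \<phi> a * \<psi> b)"
    by (rule bounded_cbilinearI[OF _ _ *])
      (use assms in \<open>auto simp: bounded_clinear_def clinear_def scaleC_complex_def algebra_simps\<close>)
  then show ?thesis
    by (simp add: tensor_functional_def cdual_apply_CDual ptensor_lift)
qed


section \<open>Nets\<close>

definition directed_set :: "'i set \<Rightarrow> ('i \<Rightarrow> 'i \<Rightarrow> bool) \<Rightarrow> bool"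
  where "directed_set I le \<longleftrightarrow>
    I \<noteq> {} \<and> (\<forall>i\<in>I. le i i) \<and>
    (\<forall>i\<in>I. \<forall>j\<in>I. \<forall>k\<in>I. le i j \<longrightarrow> le j k \<longrightarrow> le i k) \<and>
    (\<forall>i\<in>I. \<forall>j\<in>I. \<exists>k\<in>I. le i k \<and> le j k)"

definition net_filter :: "'i set \<Rightarrow> ('i \<Rightarrow> 'i \<Rightarrow> bool) \<Rightarrow> 'i filter"
  where "net_filter I le = (INF i\<in>I. principal {j \<in> I. le i j})"

text \<open>
  An existential quantifier over nets has to fix the type of the indices.  The following type
  is large enough for nets in \<^typ>\<open>'x\<close>: by \<open>net_reindex\<close> below, every net, over whatever index
  type, has the same values and the same eventual behaviour as a net indexed by this type.
\<close>

type_synonym 'x net_index = "'x \<times> 'x set"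

lemma directed_setD:
  assumes "directed_set I le"
  shows "I \<noteq> {}" "i \<in> I \<Longrightarrow> le i i"
    "i \<in> I \<Longrightarrow> j \<in> I \<Longrightarrow> k \<in> I \<Longrightarrow> le i j \<Longrightarrow> le j k \<Longrightarrow> le i k"
    "i \<in> I \<Longrightarrow> j \<in> I \<Longrightarrow> \<exists>k\<in>I. le i k \<and> le j k"
  using assms unfolding directed_set_def by blast+

lemma eventually_net_filter:
  assumes "directed_set I le"
  shows "eventually Q (net_filter I le) \<longleftrightarrow> (\<exists>i\<in>I. \<forall>j\<in>I. le i j \<longrightarrow> Q j)"
proof -
  have "eventually Q (net_filter I le) \<longleftrightarrow> (\<exists>i\<in>I. eventually Q (principal {j \<in> I. le i j}))"
    unfolding net_filter_def
  proof (rule eventually_INF_base)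
    show "I \<noteq> {}" by (rule directed_setD(1)[OF assms])
    fix i j assume ij: "i \<in> I" "j \<in> I"
    then obtain k where k: "k \<in> I" "le i k" "le j k" using directed_setD(4)[OF assms] by blast
    have "{l \<in> I. le k l} \<subseteq> {l \<in> I. le i l} \<inter> {l \<in> I. le j l}"
      using directed_setD(3)[OF assms ij(1) k(1) _ k(2)] directed_setD(3)[OF assms ij(2) k(1) _ k(3)] by blast
    with \<open>k \<in> I\<close> show "\<exists>x\<in>I. principal {j \<in> I. le x j} \<le> inf (principal {j \<in> I. le i j}) (principal {l \<in> I. le j l})"
      by auto
  qed
  then show ?thesis by (auto simp: eventually_principal)
qed

lemma net_reindex:
  fixes u :: "'i \<Rightarrow> 'x"
  assumes I: "directed_set I le"
  obtains J :: "'x net_index set" and le' v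
  where "directed_set J le'" "v ` J = u ` I"
    "filtermap v (net_filter J le') = filtermap u (net_filter I le)"
proof -
  define S where "S i = u ` {j \<in> I. le i j}" for i
  define J where "J = {(x, T). \<exists>i\<in>I. T = S i \<and> x \<in> S i}"
  define le' :: "'x net_index \<Rightarrow> 'x net_index \<Rightarrow> bool" where "le' p q \<longleftrightarrow> snd q \<subseteq> snd p" for p q
  have self: "(u i, S i) \<in> J" if "i \<in> I" for i
    using that directed_setD(2)[OF I that] by (auto simp: J_def S_def)
  have J: "directed_set J le'"
    unfolding directed_set_def[of J]
  proof (intro conjI ballI impI)
    show "J \<noteq> {}" using self directed_setD(1)[OF I] by blast
    fix p q assume "p \<in> J" "q \<in> J"
    then obtain i j where ij: "i \<in> I" "j \<in> I" "snd p = S i" "snd q = S j" by (auto simp: J_def)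
    then obtain k where k: "k \<in> I" "le i k" "le j k" using directed_setD(4)[OF I] by blast
    have "S k \<subseteq> S i" "S k \<subseteq> S j"
      unfolding S_def
      using directed_setD(3)[OF I ij(1) k(1) _ k(2)] directed_setD(3)[OF I ij(2) k(1) _ k(3)] by blast+
    with k ij show "\<exists>k\<in>J. le' p k \<and> le' q k"
      by (intro bexI[OF _ self[of k]]) (auto simp: le'_def)
  qed (auto simp: le'_def)
  have "eventually Q (filtermap fst (net_filter J le')) \<longleftrightarrow> eventually Q (filtermap u (net_filter I le))" for Q
  proof -
    have "eventually Q (filtermap fst (net_filter J le')) \<longleftrightarrow> (\<exists>p\<in>J. \<forall>q\<in>J. le' p q \<longrightarrow> Q (fst q))"
      by (simp add: eventually_filtermap eventually_net_filter[OF J])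
    also have "\<dots> \<longleftrightarrow> (\<exists>i\<in>I. \<forall>x\<in>S i. Q x)"
    proof
      assume "\<exists>p\<in>J. \<forall>q\<in>J. le' p q \<longrightarrow> Q (fst q)"
      then obtain p where p: "p \<in> J" "\<forall>q\<in>J. le' p q \<longrightarrow> Q (fst q)" by blast
      then obtain i where i: "i \<in> I" "snd p = S i" by (auto simp: J_def)
      have "Q x" if "x \<in> S i" for x
        using p(2)[rule_format, of "(x, S i)"] i that by (auto simp: J_def le'_def)
      with i show "\<exists>i\<in>I. \<forall>x\<in>S i. Q x" by blast
    next
      assume "\<exists>i\<in>I. \<forall>x\<in>S i. Q x"
      then obtain i where "i \<in> I" "\<forall>x\<in>S i. Q x" by blast
      then show "\<exists>p\<in>J. \<forall>q\<in>J. le' p q \<longrightarrow> Q (fst q)"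
        by (intro bexI[OF _ self[of i]]) (auto simp: le'_def J_def)
    qed
    also have "\<dots> \<longleftrightarrow> eventually Q (filtermap u (net_filter I le))"
      by (auto simp: eventually_filtermap eventually_net_filter[OF I] S_def)
    finally show ?thesis .
  qed
  then have "filtermap fst (net_filter J le') = filtermap u (net_filter I le)"
    by (simp add: filter_eq_iff)
  moreover have "fst ` J = u ` I"
  proof
    show "fst ` J \<subseteq> u ` I" unfolding J_def S_def by auto
    show "u ` I \<subseteq> fst ` J"
    proof
      fix x assume "x \<in> u ` I"
      then obtain i where "i \<in> I" "x = fst (u i, S i)" by auto
      then show "x \<in> fst ` J" using self by blast
    qed
  qed
  ultimately show ?thesis using that[OF J] by simp
qed

end

theory Submission
  imports Defs
begin

text \<open>
  By duality the restriction of a mean \<open>m\<close> to the predual is evaluation at some \<open>e\<close> in the algebra, and for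
  \<open>\<phi> a\<^sub>0 = 1\<close> the constant net \<open>e a\<^sub>0 \<otimes> a\<^sub>0\<close> satisfies (i) and (ii) exactly, since for every
  \<open>T\<close> in \<open>\<sigma>wc\<close> the functional \<open>a \<mapsto> T (a a\<^sub>0 \<otimes> a\<^sub>0)\<close> is
  weak*-continuous and therefore lies in the predual, as \<open>\<phi>\<close> does.  Conversely,
  \<open>f \<otimes> \<phi>\<close> is in \<open>\<sigma>wc\<close> whenever \<open>f\<close> is, and a mean is obtained as a limit of
  \<open>f \<mapsto> (f \<otimes> \<phi>) u\<^sub>\<alpha>\<close> along a subnet on which all these values converge.
\<close>

section \<open>Continuity into initial, weak and weak* topologies\<close>

lemma continuous_map_initial_topology:
  "f \<in> F \<Longrightarrow> continuous_map (initial_topology F) euclidean f"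
  unfolding continuous_map_def
proof (intro conjI allI impI)
  fix U :: "complex set" assume f: "f \<in> F" and "openin euclidean U"
  then have U: "f -` U \<in> {f -` U |f U. f \<in> F \<and> open U}" by auto
  then have "f -` U \<subseteq> topspace (initial_topology F)"
    unfolding initial_topology_def topology_generated_by_topspace by blast
  moreover have "openin (initial_topology F) (f -` U)"
    unfolding initial_topology_def using U by (rule topology_generated_by_Basis)
  ultimately show "openin (initial_topology F) {x \<in> topspace (initial_topology F). f x \<in> U}"
    by (metis Collect_conj_eq Collect_mem_eq inf.absorb_iff2 vimage_def)
qed simp

text \<open>It suffices to check preimages of subbasic sets. Nonemptiness of \<open>F\<close> makes
  the generated topology live on the whole type; for empty \<open>F\<close> its topspace is
  empty.\<close>

lemma continuous_map_into_initial_topology: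
  assumes ne: "F \<noteq> {}" and c: "\<And>f. f \<in> F \<Longrightarrow> continuous_map X euclidean (\<lambda>x. f (g x))"
  shows "continuous_map X (initial_topology F) g"
proof -
  obtain f where f: "f \<in> F" using ne by blast
  then have "UNIV \<in> {f -` U |f U. f \<in> F \<and> open U}"
    by (intro CollectI exI[of _ f] exI[of _ UNIV]) simp
  then have "\<Union> {f -` U |f U. f \<in> F \<and> open U} = UNIV" by blast
  moreover have "openin X (g -` U \<inter> topspace X)" if U: "U \<in> {f -` U |f U. f \<in> F \<and> open U}" for U
  proof -
    obtain f V where "f \<in> F" "open V" "U = f -` V" using U by blast
    then have "openin X {x \<in> topspace X. f (g x) \<in> V}"
      using c openin_continuous_map_preimage[of X euclidean "\<lambda>x. f (g x)" V] by simp
    moreover have "{x \<in> topspace X. f (g x) \<in> V} = g -` U \<inter> topspace X"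
      using \<open>U = f -` V\<close> by blast
    ultimately show ?thesis by simp
  qed
  ultimately show ?thesis
    unfolding initial_topology_def by (intro continuous_on_generated_topo) auto
qed

text \<open>The form in which membership in \<open>sigma_wc\<close> is unfolded below: one scalar
  condition per functional.\<close>

lemma continuous_map_weak_topology_iff:
  "continuous_map X weak_topology g \<longleftrightarrow>
    (\<forall>F. continuous_map X euclidean (\<lambda>x. cdual_apply F (g x)))"
proof
  assume "continuous_map X weak_topology g"
  then show "\<forall>F. continuous_map X euclidean (\<lambda>x. cdual_apply F (g x))"
    using continuous_map_compose[of X weak_topology g euclidean]
      continuous_map_initial_topology[of _ "range cdual_apply"]
    by (auto simp: weak_topology_def comp_def)
next
  assume "\<forall>F. continuous_map X euclidean (\<lambda>x. cdual_apply F (g x))"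
  then show "continuous_map X weak_topology g"
    unfolding weak_topology_def by (intro continuous_map_into_initial_topology) auto
qed

lemma continuous_map_wkstar_predual:
  "f \<in> P \<Longrightarrow> continuous_map (wkstar_topology P) euclidean (cdual_apply f)"
  unfolding wkstar_topology_def by (rule continuous_map_initial_topology) simp

text \<open>Since every member of \<open>F\<close> vanishes at \<open>x0\<close>, a subbasic set
  containing \<open>x0\<close> contains some {|f| < e}. Induction on the generation of
  \<open>S\<close> does the rest: an intersection takes the union of the two finite families and the
  smaller radius.\<close>

lemma initial_topology_nhds_zero:
  assumes "openin (initial_topology F) S" "x0 \<in> S" and z: "\<And>f. f \<in> F \<Longrightarrow> f x0 = 0"
  obtains G e where "finite G" "G \<subseteq> F" "0 < e" "{x. \<forall>f\<in>G. cmod (f x) < e} \<subseteq> S"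
proof -
  have "generate_topology_on {f -` U |f U. f \<in> F \<and> open U} S"
    using assms(1) by (simp add: initial_topology_def openin_topology_generated_by_iff)
  then have "x0 \<in> S \<longrightarrow> (\<exists>G e. finite G \<and> G \<subseteq> F \<and> 0 < e \<and> {x. \<forall>f\<in>G. cmod (f x) < e} \<subseteq> S)"
  proof induction
    case (Int A B)
    show ?case
    proof
      assume "x0 \<in> A \<inter> B"
      with Int obtain G d H e where
        G: "finite G" "G \<subseteq> F" "0 < d" "{x. \<forall>f\<in>G. cmod (f x) < d} \<subseteq> A" and
        H: "finite H" "H \<subseteq> F" "0 < e" "{x. \<forall>f\<in>H. cmod (f x) < e} \<subseteq> B" by auto
      then show "\<exists>G e. finite G \<and> G \<subseteq> F \<and> 0 < e \<and> {x. \<forall>f\<in>G. cmod (f x) < e} \<subseteq> A \<inter> B"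
        by (intro exI[of _ "G \<union> H"] exI[of _ "min d e"]) auto
    qed
  next
    case (UN K)
    then show ?case by (meson Union_iff Union_upper order_trans)
  next
    case (Basis s)
    then obtain f U where f: "s = f -` U" "f \<in> F" "open U" by blast
    show ?case
    proof
      assume "x0 \<in> s"
      then have "0 \<in> U" using f z by force
      then obtain e where "0 < e" "ball 0 e \<subseteq> U" using \<open>open U\<close> open_contains_ball by blast
      then show "\<exists>G e. finite G \<and> G \<subseteq> F \<and> 0 < e \<and> {x. \<forall>f\<in>G. cmod (f x) < e} \<subseteq> s"
        using f by (intro exI[of _ "{f}"] exI[of _ e]) auto
    qed
  qed auto
  with assms(2) that show thesis by blast
qed

section \<open>Weak*-continuous functionals lie in the predual\<close>

lemma clinear_cdual_apply: "clinear (cdual_apply F)"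
  using cdual_apply_bounded_clinear by (auto simp: bounded_clinear_def)

lemma cdual_in_span_of_kernels:
  assumes "finite F" "csubspace P" "F \<subseteq> P"
    and "\<And>x. (\<forall>p\<in>F. cdual_apply p x = 0) \<Longrightarrow> cdual_apply G x = 0"
  shows "G \<in> P"
  using assms
proof (induction F arbitrary: G)
  case empty
  then have "G = 0" by (intro cdual_eqI) simp
  with empty show ?case by (simp add: csubspace_def)
next
  case (insert p F)
  note lin = clinearD[OF clinear_cdual_apply]
  show ?case
  proof (cases "\<forall>x. (\<forall>q\<in>F. cdual_apply q x = 0) \<longrightarrow> cdual_apply p x = 0")
    case True
    then show ?thesis using insert by (intro insert.IH) auto
  next
    case False
    then obtain y where y: "\<forall>q\<in>F. cdual_apply q y = 0" "cdual_apply p y \<noteq> 0" by blast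
    \<comment> \<open>With this \<open>c\<close>, \<open>G - c *\<^sub>C p\<close> vanishes at
      \<open>y\<close>. Below, \<open>z\<close> is \<open>x\<close> moved along \<open>y\<close>
      into the kernel of \<open>p\<close>; it stays in the kernels of \<open>F\<close>, and
      \<open>G\<close> at \<open>z\<close> equals \<open>G - c *\<^sub>C p\<close> at
      \<open>x\<close>.\<close>
    define c where "c = cdual_apply G y / cdual_apply p y"
    have "G - c *\<^sub>C p \<in> P"
    proof (rule insert.IH)
      fix x assume x: "\<forall>q\<in>F. cdual_apply q x = 0"
      define z where "z = x - (cdual_apply p x / cdual_apply p y) *\<^sub>C y"
      have "\<forall>q\<in>insert p F. cdual_apply q z = 0"
        using x y by (simp add: z_def lin scaleC_complex_def)
      then have "cdual_apply G z = 0" by (rule insert.prems)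
      then show "cdual_apply (G - c *\<^sub>C p) x = 0"
        by (simp add: z_def c_def lin scaleC_complex_def)
    qed (use insert.prems in auto)
    moreover have "c *\<^sub>C p \<in> P" using insert.prems by (simp add: csubspace_def)
    ultimately have "(G - c *\<^sub>C p) + c *\<^sub>C p \<in> P"
      using insert.prems(1) unfolding csubspace_def by blast
    then show ?thesis by simp
  qed
qed

text \<open>Continuity at 0 gives finitely many elements of \<open>P\<close> such that
  \<open>G\<close> is bounded by 1 where they are small, in particular on their common kernel. A
  functional bounded on a subspace vanishes there, so \<open>G\<close> is in their span.\<close>

lemma wkstar_continuous_in_predual:
  assumes P: "dual_banach_algebra P"
    and cm: "continuous_map (wkstar_topology P) euclidean (cdual_apply G)"
  shows "G \<in> P"
proof -
  have sub: "csubspace P" using P by (simp add: dual_banach_algebra_def)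
  note lin = clinearD[OF clinear_cdual_apply]
  have "openin (wkstar_topology P) {x \<in> topspace (wkstar_topology P). cdual_apply G x \<in> ball 0 1}"
    using cm by (rule openin_continuous_map_preimage) simp
  then have op: "openin (initial_topology (cdual_apply ` P)) {x. cmod (cdual_apply G x) < 1}"
    by (simp add: topspace_wkstar_topology[OF P] wkstar_topology_def[symmetric])
  obtain H e where H: "finite H" "H \<subseteq> cdual_apply ` P" "0 < e"
      "{x. \<forall>f\<in>H. cmod (f x) < e} \<subseteq> {x. cmod (cdual_apply G x) < 1}"
    by (rule initial_topology_nhds_zero[OF op, of 0]) (auto simp: lin)
  obtain F where F: "finite F" "F \<subseteq> P" "H = cdual_apply ` F"
    using finite_subset_image[OF H(1,2)] by blast
  show ?thesis
  proof (rule cdual_in_span_of_kernels[OF F(1) sub F(2)])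
    fix x assume x: "\<forall>p\<in>F. cdual_apply p x = 0"
    show "cdual_apply G x = 0"
    proof (rule ccontr)
      assume nz: "cdual_apply G x \<noteq> 0"
      \<comment> \<open>The rescaled point is still in the common kernel, but \<open>G\<close> takes
        the value 1 there.\<close>
      have "(1 / cdual_apply G x) *\<^sub>C x \<in> {x. \<forall>f\<in>H. cmod (f x) < e}"
        using x F(3) H(3) by (simp add: lin scaleC_complex_def)
      then have "cmod (cdual_apply G ((1 / cdual_apply G x) *\<^sub>C x)) < 1" using H(4) by blast
      with nz show False by (simp add: lin scaleC_complex_def)
    qed
  qed
qed

section \<open>Elements of the predual: module actions, the character, slices\<close>

lemma cdual_bounded_clinear_on: "bounded_clinear_on S (cdual_apply F)"
  unfolding bounded_clinear_on_def
  using norm_cdual_apply by (auto simp: clinearD[OF clinear_cdual_apply] scaleC_complex_def)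

text \<open>
  Weak continuity is meant in the dual of the algebra, but a functional on that dual acts on the
  predual as an element of the algebra.
\<close>

lemma predual_subset_sigma_wc_dual:
  assumes P: "dual_banach_algebra P" shows "P \<subseteq> sigma_wc_dual P"
proof
  fix f assume f: "f \<in> P"
  note ap = cdual_apply_dual_left[OF banach_bimodule_mult] cdual_apply_dual_right[OF banach_bimodule_mult]
  have mod: "dual_left (*) a f \<in> P" "dual_right (*) f a \<in> P" for a
    using P f by (auto simp: dual_banach_algebra_def)
  have "continuous_map (wkstar_topology P) euclidean (\<lambda>a. cdual_apply F (dual_left (*) a f)) \<and>
    continuous_map (wkstar_topology P) euclidean (\<lambda>a. cdual_apply F (dual_right (*) f a))" for F
  proof -
    \<comment> \<open>The sides are exchanged: F(a.f) = (a.f)(e) = f(ea) = (f.e)(a), and likewise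
      F(f.a) = (e.f)(a). Both are evaluations at \<open>a\<close> of elements of \<open>P\<close>,
      hence weak*-continuous.\<close>
    obtain e where "\<forall>p\<in>P. cdual_apply F p = cdual_apply p e"
      using P cdual_bounded_clinear_on unfolding dual_banach_algebra_def by blast
    then have "(\<lambda>a. cdual_apply F (dual_left (*) a f)) = cdual_apply (dual_right (*) f e)"
      "(\<lambda>a. cdual_apply F (dual_right (*) f a)) = cdual_apply (dual_left (*) e f)"
      using mod by (auto simp: ap)
    then show ?thesis by (simp add: mod continuous_map_wkstar_predual)
  qed
  then show "f \<in> sigma_wc_dual P"
    by (simp add: sigma_wc_dual_def sigma_wc_def continuous_map_weak_topology_iff)
qed

lemma wkstar_character_in_predual:
  assumes P: "dual_banach_algebra P" and phi: "\<phi> \<in> wkstar_characters P"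
  shows "CDual \<phi> \<in> P"
  by (rule wkstar_continuous_in_predual[OF P])
    (use phi in \<open>simp add: cdual_apply_CDual[OF wkstar_character_bounded[OF P phi]] wkstar_characters_def\<close>)

text \<open>Makes \<open>x\<close> an element of the bidual, to be used as a test functional for
  weak continuity.\<close>

lemma bounded_clinear_eval: "bounded_clinear (\<lambda>F. cdual_apply F x)"
  unfolding bounded_clinear_def clinear_def
  by (auto simp: scaleC_complex_def intro!: exI[of _ "norm x"]) (metis norm_cdual_apply mult.commute)

text \<open>The map a -> T.a is weak*-weakly continuous; testing it against evaluation at
  \<open>w\<close> gives a -> (T.a)(w) = T(a.w), which is therefore weak*-continuous.\<close>

lemma sigma_wc_ptensor_dual_slice_in_predual:
  assumes P: "dual_banach_algebra P" and T: "T \<in> sigma_wc_ptensor_dual P"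
  shows "CDual (\<lambda>a. cdual_apply T (ptensor_left a w)) \<in> P" (is "?G \<in> _")
    and "cdual_apply (CDual (\<lambda>a. cdual_apply T (ptensor_left a w))) a = cdual_apply T (ptensor_left a w)"
proof -
  have "bounded_clinear (\<lambda>a. ptensor_left a w)"
    using banach_bimodule_ptensor bounded_cbilinear_partial(2) unfolding banach_bimodule_def by blast
  then have bc: "bounded_clinear (\<lambda>a. cdual_apply T (ptensor_left a w))"
    by (rule bounded_clinear_compose[OF cdual_apply_bounded_clinear])
  show "cdual_apply ?G a = cdual_apply T (ptensor_left a w)" by (simp add: cdual_apply_CDual[OF bc])
  have "continuous_map (wkstar_topology P) euclidean
      (\<lambda>a. cdual_apply (CDual (\<lambda>F. cdual_apply F w)) (dual_right ptensor_left T a))"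
    using T by (simp add: sigma_wc_ptensor_dual_def sigma_wc_def continuous_map_weak_topology_iff)
  then show "?G \<in> P"
    by (intro wkstar_continuous_in_predual[OF P])
      (simp add: cdual_apply_CDual[OF bc] cdual_apply_CDual[OF bounded_clinear_eval]
        cdual_apply_dual_right[OF banach_bimodule_ptensor])
qed

section \<open>From a mean to a diagonal element\<close>

text \<open>On the predual, invariance of the mean reads f(ae) = \<phi>(a) f(e). Applied to the
  slice f(b) = T(b.w), this is exactly T(a.u) = \<phi>(a) T(u) for u = e.w.\<close>

lemma Connes_amenable_imp_diagonal_element:
  assumes P: "dual_banach_algebra P" and phi: "\<phi> \<in> wkstar_characters P"
    and am: "Connes_amenable P \<phi>"
  obtains u where
    "\<And>a T. T \<in> sigma_wc_ptensor_dual P \<Longrightarrow> cdual_apply T (ptensor_left a u - \<phi> a *\<^sub>C u) = 0"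
    "cdual_apply (tensor_functional \<phi> \<phi>) u = 1"
proof -
  note bphi = wkstar_character_bounded[OF P phi]
  have mult: "\<phi> (a * b) = \<phi> a * \<phi> b" and cphi: "clinear \<phi>" for a b
    using phi by (auto simp: wkstar_characters_def)
  obtain a1 where "\<phi> a1 \<noteq> 0" using phi by (auto simp: wkstar_characters_def)
  define a0 where "a0 = (1 / \<phi> a1) *\<^sub>C a1"
  have a0: "\<phi> a0 = 1" using \<open>\<phi> a1 \<noteq> 0\<close> by (simp add: a0_def clinearD[OF cphi] scaleC_complex_def)
  obtain m where m: "bounded_clinear_on (sigma_wc_dual P) m" "m (CDual \<phi>) = 1"
      "\<And>a f. f \<in> sigma_wc_dual P \<Longrightarrow> m (dual_right (*) f a) = \<phi> a * m f"
    using am unfolding Connes_amenable_def by blast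
  note PS = predual_subset_sigma_wc_dual[OF P]
  have "bounded_clinear_on P m"
    using m(1) PS unfolding bounded_clinear_on_def by (meson subsetD)
  then obtain e where e: "\<And>f. f \<in> P \<Longrightarrow> m f = cdual_apply f e"
    using P unfolding dual_banach_algebra_def by blast
  define w where "w = a0 \<otimes>\<^sub>p a0"
  show thesis
  proof (rule that[of "ptensor_left e w"])
    \<comment> \<open>The character lies in the predual, so its value at \<open>e\<close> is the
      value of the mean on it.\<close>
    have "\<phi> e = 1"
      using e[OF wkstar_character_in_predual[OF P phi]] m(2) by (simp add: cdual_apply_CDual[OF bphi])
    then show "cdual_apply (tensor_functional \<phi> \<phi>) (ptensor_left e w) = 1"
      by (simp add: w_def ptensor_left cdual_apply_tensor_functional[OF bphi bphi] mult a0)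
    fix a T assume T: "T \<in> sigma_wc_ptensor_dual P"
    define f where "f = CDual (\<lambda>a. cdual_apply T (ptensor_left a w))"
    have f: "f \<in> P" "\<And>a. cdual_apply f a = cdual_apply T (ptensor_left a w)"
      unfolding f_def by (rule sigma_wc_ptensor_dual_slice_in_predual[OF P T])+
    have "dual_right (*) f a \<in> P" using P f(1) by (simp add: dual_banach_algebra_def)
    then have "cdual_apply f (a * e) = \<phi> a * cdual_apply f e"
      using m(3)[of f a] e f(1) PS by (auto simp: cdual_apply_dual_right[OF banach_bimodule_mult])
    moreover have "ptensor_left (a * e) w = ptensor_left a (ptensor_left e w)"
      using banach_bimodule_ptensor unfolding banach_bimodule_def by blast
    ultimately show "cdual_apply T (ptensor_left a (ptensor_left e w) - \<phi> a *\<^sub>C ptensor_left e w) = 0"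
      by (simp add: f clinearD[OF clinear_cdual_apply] scaleC_complex_def)
  qed
qed

section \<open>Convergent subfilters of bounded families\<close>

text \<open>Tychonoff: the maps \<open>g i\<close> eventually lie in a product of closed discs of
  radii \<open>C f\<close>, so they have a cluster point \<open>m\<close>. The finer filter
  \<open>G\<close> takes the place of a subnet.\<close>

lemma bounded_family_convergent_subfilter:
  fixes g :: "'i \<Rightarrow> 'f \<Rightarrow> complex"
  assumes N: "N \<noteq> bot" and bd: "eventually (\<lambda>i. \<forall>f. cmod (g i f) \<le> C f) N"
  obtains G m where "G \<noteq> bot" "G \<le> N" "\<And>f. ((\<lambda>i. g i f) \<longlongrightarrow> m f) G"
proof -
  let ?K = "PiE UNIV (\<lambda>f. cball 0 (C f)) :: ('f \<Rightarrow> complex) set"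
  have "compactin (product_topology (\<lambda>_. euclidean) UNIV) ?K"
    by (simp add: compactin_PiE)
  then have "compact ?K" by (simp add: euclidean_product_topology)
  moreover have "eventually (\<lambda>h. h \<in> ?K) (filtermap g N)"
    using bd by (simp add: eventually_filtermap PiE_UNIV_domain Pi_iff)
  ultimately obtain m where m: "inf (nhds m) (filtermap g N) \<noteq> bot"
    using N unfolding compact_filter by (metis filtermap_bot_iff)
  \<comment> \<open>\<open>G\<close> adds to \<open>N\<close> the preimages of the neighbourhoods of
    \<open>m\<close>. Were it trivial, \<open>g\<close> would eventually avoid some neighbourhood of
    \<open>m\<close>, contradicting that \<open>m\<close> is a cluster point.\<close>
  define G where "G = inf N (filtercomap g (nhds m))"
  have "G \<noteq> bot"
  proof
    assume "G = bot"
    then have "eventually (\<lambda>_. False) (inf N (filtercomap g (nhds m)))" by (simp add: G_def)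
    then obtain Q R where Q: "eventually Q N" and R: "eventually R (nhds m)" "\<And>i. Q i \<Longrightarrow> \<not> R (g i)"
      unfolding eventually_inf eventually_filtercomap by blast
    have "eventually (\<lambda>h. \<not> R h) (filtermap g N)"
      unfolding eventually_filtermap using Q R(2) by (rule eventually_mono)
    then have "eventually (\<lambda>_. False) (inf (nhds m) (filtermap g N))"
      unfolding eventually_inf using R(1) by blast
    with m show False by (simp add: trivial_limit_def)
  qed
  moreover have "G \<le> N" by (simp add: G_def)
  moreover have "((\<lambda>i. g i f) \<longlongrightarrow> m f) G" for f
  proof -
    have "((\<lambda>h :: 'f \<Rightarrow> complex. h f) \<longlongrightarrow> m f) (nhds m)"
      using continuous_on_product_coordinates[of f, where 'b=complex]
        tendsto_at_iff_tendsto_nhds[of "\<lambda>h. h f" m]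
      by (simp add: continuous_on_def)
    moreover have "(g \<longlongrightarrow> m) G"
      unfolding G_def filterlim_iff_le_filtercomap by simp
    ultimately show ?thesis by (rule filterlim_compose)
  qed
  ultimately show thesis by (rule that)
qed

section \<open>Tensor products of a functional with a character\<close>

text \<open>The bound keeps the factor \<open>norm f\<close> explicit, so that it later bounds the
  operator sending f to f tensor \<psi>.\<close>

lemma bounded_cbilinear_functional_product:
  assumes L: "bounded_clinear \<psi>" "0 \<le> L" "\<And>x. cmod (\<psi> x) \<le> L * norm x"
  shows "bounded_cbilinear (\<lambda>a b. cdual_apply f a * \<psi> b)"
    and "cmod (cdual_apply f a * \<psi> b) \<le> (norm f * L) * norm a * norm b"
proof -
  show b: "cmod (cdual_apply f a * \<psi> b) \<le> (norm f * L) * norm a * norm b" for a b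
    using mult_mono[OF norm_cdual_apply[of f a] L(3)[of b]]
    by (simp add: norm_mult algebra_simps)
  have "clinear \<psi>" using L by (simp add: bounded_clinear_def)
  then show "bounded_cbilinear (\<lambda>a b. cdual_apply f a * \<psi> b)"
    by (intro bounded_cbilinearI[OF _ _ b])
      (auto simp: clinear_def clinearD[OF clinear_cdual_apply] scaleC_complex_def algebra_simps)
qed

lemma norm_tensor_functional_le:
  assumes L: "bounded_clinear \<psi>" "0 \<le> L" "\<And>x. cmod (\<psi> x) \<le> L * norm x"
  shows "norm (tensor_functional (cdual_apply f) \<psi>) \<le> L * norm f"
proof (rule norm_cdual_bound)
  fix u
  note b = bounded_cbilinear_functional_product[OF L]
  show "cmod (cdual_apply (tensor_functional (cdual_apply f) \<psi>) u) \<le> L * norm f * norm u"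
    using norm_ptensor_lift[OF b(1) _ b(2), of f u] L(2)
    by (simp add: tensor_functional_def cdual_apply_CDual[OF ptensor_lift(1)[OF b(1)]] mult.commute[of L])
qed (use L in simp)

lemma ptensor_cdual_eqI:
  assumes "\<And>a b. cdual_apply S (a \<otimes>\<^sub>p b) = cdual_apply T (a \<otimes>\<^sub>p b)"
  shows "S = T"
  using ptensor_eqI[OF cdual_apply_bounded_clinear cdual_apply_bounded_clinear assms]
  by (simp add: cdual_apply_inject)

lemma bounded_clinear_tensor_functional:
  assumes psi: "bounded_clinear \<psi>"
  shows "bounded_clinear (\<lambda>f. tensor_functional (cdual_apply f) \<psi>)"
proof -
  obtain K where K: "\<And>x. cmod (\<psi> x) \<le> K * norm x" using psi by (auto simp: bounded_clinear_def)
  have K': "cmod (\<psi> x) \<le> \<bar>K\<bar> * norm x" for x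
    by (rule order_trans[OF K]) (simp add: mult_right_mono)
  note ap = cdual_apply_tensor_functional[OF cdual_apply_bounded_clinear psi]
  show ?thesis
    unfolding bounded_clinear_def clinear_def
    using norm_tensor_functional_le[OF psi _ K']
    by (auto intro!: ptensor_cdual_eqI simp: ap algebra_simps)
qed

text \<open>The left action on tensors touches only the first factor, so its dual acts on
  \<open>f\<close> alone.\<close>

lemma dual_right_tensor_functional:
  assumes "bounded_clinear \<psi>"
  shows "dual_right ptensor_left (tensor_functional (cdual_apply f) \<psi>) a =
    tensor_functional (cdual_apply (dual_right (*) f a)) \<psi>"
  by (rule ptensor_cdual_eqI)
    (simp add: cdual_apply_dual_right[OF banach_bimodule_ptensor] ptensor_left
      cdual_apply_tensor_functional[OF cdual_apply_bounded_clinear assms]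
      cdual_apply_dual_right[OF banach_bimodule_mult])

text \<open>One action multiplies the functional by the weak*-continuous scalar \<phi>(a), as \<phi>
  is multiplicative; the other replaces \<open>f\<close> by f.a, where the hypothesis on
  \<open>f\<close> applies.\<close>

lemma tensor_functional_in_sigma_wc:
  assumes P: "dual_banach_algebra P" and phi: "\<phi> \<in> wkstar_characters P"
    and f: "f \<in> sigma_wc_dual P"
  shows "tensor_functional (cdual_apply f) \<phi> \<in> sigma_wc_ptensor_dual P"
proof -
  note bphi = wkstar_character_bounded[OF P phi]
  have mult: "\<phi> (a * b) = \<phi> a * \<phi> b" and cm: "continuous_map (wkstar_topology P) euclidean \<phi>" for a b
    using phi by (auto simp: wkstar_characters_def)
  let ?T = "\<lambda>f. tensor_functional (cdual_apply f) \<phi>"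
  have left: "dual_left ptensor_right a (?T f) = \<phi> a *\<^sub>C ?T f" for a
  proof (rule ptensor_cdual_eqI)
    show "\<And>b c. cdual_apply (dual_left ptensor_right a (?T f)) (b \<otimes>\<^sub>p c) =
        cdual_apply (\<phi> a *\<^sub>C ?T f) (b \<otimes>\<^sub>p c)"
      by (simp add: cdual_apply_dual_left[OF banach_bimodule_ptensor] ptensor_right mult
          cdual_apply_tensor_functional[OF cdual_apply_bounded_clinear bphi])
  qed
  have "continuous_map (wkstar_topology P) euclidean
      (\<lambda>a. cdual_apply F (dual_left ptensor_right a (?T f)))" for F
    using continuous_map_compose[OF cm, of euclidean "\<lambda>z. z * cdual_apply F (?T f)"]
    by (simp add: left clinearD[OF clinear_cdual_apply] scaleC_complex_def comp_def
        continuous_on_mult_right)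
  moreover have "continuous_map (wkstar_topology P) euclidean
      (\<lambda>a. cdual_apply F (dual_right ptensor_left (?T f) a))" for F
  proof -
    \<comment> \<open>Composing \<open>F\<close> with f -> f tensor \<phi> gives a functional on the
      dual of the algebra, against which the weak continuity of a -> f.a is tested.\<close>
    have bc: "bounded_clinear (\<lambda>f. cdual_apply F (?T f))"
      by (rule bounded_clinear_compose[OF cdual_apply_bounded_clinear
            bounded_clinear_tensor_functional[OF bphi]])
    have "continuous_map (wkstar_topology P) euclidean
        (\<lambda>a. cdual_apply (CDual (\<lambda>f. cdual_apply F (?T f))) (dual_right (*) f a))"
      using f by (simp add: sigma_wc_dual_def sigma_wc_def continuous_map_weak_topology_iff)
    then show ?thesis by (simp add: cdual_apply_CDual[OF bc] dual_right_tensor_functional[OF bphi])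
  qed
  ultimately show ?thesis
    by (simp add: sigma_wc_ptensor_dual_def sigma_wc_def continuous_map_weak_topology_iff)
qed

section \<open>From a bounded net to a mean, and the equivalence\<close>

lemma approximate_diagonal_imp_Connes_amenable:
  assumes P: "dual_banach_algebra P" and phi: "\<phi> \<in> wkstar_characters P"
    and N: "N \<noteq> bot" and K: "eventually (\<lambda>i. norm (u i) \<le> K) N"
    and inv: "\<And>a T. T \<in> sigma_wc_ptensor_dual P \<Longrightarrow>
      ((\<lambda>i. cdual_apply T (ptensor_left a (u i) - \<phi> a *\<^sub>C u i)) \<longlongrightarrow> 0) N"
    and one: "((\<lambda>i. cdual_apply (tensor_functional \<phi> \<phi>) (u i)) \<longlongrightarrow> 1) N"
  shows "Connes_amenable P \<phi>"
proof -
  note bphi = wkstar_character_bounded[OF P phi]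
  let ?T = "\<lambda>f. tensor_functional (cdual_apply f) \<phi>"
  have cT: "clinear ?T" and "\<exists>L. \<forall>f. norm (?T f) \<le> L * norm f"
    using bounded_clinear_tensor_functional[OF bphi] by (auto simp: bounded_clinear_def)
  then obtain L where L: "\<And>f. norm (?T f) \<le> L * norm f" by blast
  have bd: "eventually (\<lambda>i. \<forall>f. cmod (cdual_apply (?T f) (u i)) \<le> L * norm f * K) N"
    using K
  proof (rule eventually_mono, intro allI)
    fix i f assume "norm (u i) \<le> K"
    then show "cmod (cdual_apply (?T f) (u i)) \<le> L * norm f * K"
      using norm_cdual_apply[of "?T f" "u i"] L[of f]
      by (meson mult_mono' norm_ge_zero order_trans)
  qed
  \<comment> \<open>The values are taken at every \<open>f\<close> in the dual, so \<open>m\<close>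
    is linear and bounded on all of it; \<open>sigma_wc_dual\<close> enters through the
    invariance.\<close>
  obtain G m where G: "G \<noteq> bot" "G \<le> N" and m: "\<And>f. ((\<lambda>i. cdual_apply (?T f) (u i)) \<longlongrightarrow> m f) G"
    using bounded_family_convergent_subfilter[OF N bd] by blast
  note uniq = tendsto_unique[OF G(1)]
  have "m (f + g) = m f + m g" for f g
    using uniq[OF m[of "f + g"]] tendsto_add[OF m[of f] m[of g]] by (simp add: clinearD[OF cT])
  moreover have "m (c *\<^sub>C f) = c * m f" for c f
    using uniq[OF m[of "c *\<^sub>C f"]] tendsto_mult_left[OF m[of f], of c] by (simp add: clinearD[OF cT])
  moreover have "cmod (m f) \<le> (L * K) * norm f" for f
  proof (rule tendsto_upperbound[OF tendsto_norm[OF m[of f]] _ G(1)])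
    show "eventually (\<lambda>i. cmod (cdual_apply (?T f) (u i)) \<le> (L * K) * norm f) G"
      using filter_leD[OF G(2) bd] by (rule eventually_mono) (simp add: mult_ac)
  qed
  ultimately have "bounded_clinear_on (sigma_wc_dual P) m"
    unfolding bounded_clinear_on_def by blast
  moreover have "m (CDual \<phi>) = 1"
    using uniq[OF m[of "CDual \<phi>"]] tendsto_mono[OF G(2) one] by (simp add: cdual_apply_CDual[OF bphi])
  moreover have "m (dual_right (*) f a) = \<phi> a * m f" if f: "f \<in> sigma_wc_dual P" for f a
  proof -
    have "((\<lambda>i. cdual_apply (?T f) (ptensor_left a (u i) - \<phi> a *\<^sub>C u i)) \<longlongrightarrow> 0) G"
      by (rule tendsto_mono[OF G(2) inv[OF tensor_functional_in_sigma_wc[OF P phi f]]])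
    \<comment> \<open>The action is moved from the tensor to \<open>f\<close>, so that (i) for f
      tensor \<phi> compares the values at f.a and at \<open>f\<close>.\<close>
    moreover have "cdual_apply (?T f) (ptensor_left a v) = cdual_apply (?T (dual_right (*) f a)) v" for v
      using cdual_apply_dual_right[OF banach_bimodule_ptensor, of "?T f" a v]
      by (simp add: dual_right_tensor_functional[OF bphi])
    ultimately have "((\<lambda>i. cdual_apply (?T (dual_right (*) f a)) (u i)
        - \<phi> a * cdual_apply (?T f) (u i)) \<longlongrightarrow> 0) G"
      by (simp add: clinearD[OF clinear_cdual_apply] scaleC_complex_def)
    moreover have "((\<lambda>i. cdual_apply (?T (dual_right (*) f a)) (u i)
        - \<phi> a * cdual_apply (?T f) (u i)) \<longlongrightarrow> m (dual_right (*) f a) - \<phi> a * m f) G"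
      by (intro tendsto_diff tendsto_mult_left m)
    ultimately show ?thesis using uniq by fastforce
  qed
  ultimately show ?thesis unfolding Connes_amenable_def by blast
qed

theorem proposition3p1:
  fixes P :: "'a::complex_banach_algebra cdual set" and \<phi> :: "'a \<Rightarrow> complex"
  assumes "dual_banach_algebra P" and "\<phi> \<in> wkstar_characters P"
  shows "Connes_amenable P \<phi> \<longleftrightarrow>
    (\<exists>(I :: ('a, 'a) ptensor net_index set) le (u :: ('a, 'a) ptensor net_index \<Rightarrow> ('a, 'a) ptensor).
      directed_set I le \<and>
      (\<exists>K. \<forall>i\<in>I. norm (u i) \<le> K) \<and>
      (\<forall>a. \<forall>T\<in>sigma_wc_ptensor_dual P.
        ((\<lambda>i. cdual_apply T (ptensor_left a (u i) - \<phi> a *\<^sub>C u i)) \<longlongrightarrow> 0) (net_filter I le)) \<and>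
      ((\<lambda>i. cdual_apply (tensor_functional \<phi> \<phi>) (u i)) \<longlongrightarrow> 1) (net_filter I le))"
    (is "_ \<longleftrightarrow> ?net")
proof
  assume "Connes_amenable P \<phi>"
  then obtain v where
    v: "\<And>a T. T \<in> sigma_wc_ptensor_dual P \<Longrightarrow> cdual_apply T (ptensor_left a v - \<phi> a *\<^sub>C v) = 0"
      "cdual_apply (tensor_functional \<phi> \<phi>) v = 1"
    using Connes_amenable_imp_diagonal_element[OF assms] by blast
  \<comment> \<open>A constant net: under the total relation every index precedes every other, and
    the expressions in (i) and (ii) are constantly 0 and 1.\<close>
  show ?net
    by (rule exI[of _ UNIV], rule exI[of _ "\<lambda>_ _. True"], rule exI[of _ "\<lambda>_. v"])
      (auto simp: directed_set_def v)
next
  assume ?net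
  then obtain I :: "('a, 'a) ptensor net_index set" and le and u :: "('a, 'a) ptensor net_index \<Rightarrow> ('a, 'a) ptensor" and K
    where I: "directed_set I le" and K: "\<forall>i\<in>I. norm (u i) \<le> K"
      and inv: "\<And>a T. T \<in> sigma_wc_ptensor_dual P \<Longrightarrow>
        ((\<lambda>i. cdual_apply T (ptensor_left a (u i) - \<phi> a *\<^sub>C u i)) \<longlongrightarrow> 0) (net_filter I le)"
      and one: "((\<lambda>i. cdual_apply (tensor_functional \<phi> \<phi>) (u i)) \<longlongrightarrow> 1) (net_filter I le)"
    by blast
  \<comment> \<open>By reflexivity each tail contains its own starting index, so no tail is
    empty.\<close>
  have "net_filter I le \<noteq> bot"
    unfolding trivial_limit_def eventually_net_filter[OF I] using directed_setD(2)[OF I] by blast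
  moreover have "eventually (\<lambda>i. norm (u i) \<le> K) (net_filter I le)"
    unfolding eventually_net_filter[OF I] using K directed_setD(1)[OF I] by blast
  ultimately show "Connes_amenable P \<phi>"
    using approximate_diagonal_imp_Connes_amenable[OF assms] inv one by blast
qed

end
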